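(* Let $\sigma\ge0$ be a real number. If $f\in L\log^{(\sigma+1)/2}L$ (on $[0,1]$), then for each $k\in\mathbb{N}_0=\{0,1,2,\dots\}$ there exists a function $f_k$ on $[0,1]$ such that $$\mathbf{D}_kf=\mathbf{D}_kf_k\quad\text{for all }k\in\mathbb{N}_0,\qquad \left\|\left(\sum_{k\ge0}|f_k|^2\right)^{1/2}\right\|_{L\log^{\sigma/2}L}\le C\,\|f\|_{L\log^{(\sigma+1)/2}L},$$ where the constant $C$ depends only on $\sigma$.
   Context: The underlying probability space is $([0,1],dx)$. For $k\in\mathbb{N}_0$, $\mathcal{D}_k$ is the collection of dyadic subintervals of $[0,1]$ of length $2^{-k}$, and for $f\in L^1([0,1])$ $$\mathbf{E}_kf:=\sum_{I\in\mathcal{D}_k}\left(\frac1{|I|}\int_If\right)\mathbf{1}_I,\qquad \mathbf{D}_kf:=\mathbf{E}_kf-\mathbf{E}_{k-1}f\ (k\ge1),\qquad \mathbf{D}_0f:=\mathbf{E}_0f .$$ For $s\ge0$ let $B_s(t):=t(\log(e+t))^s$. The space $L\log^sL$ consists of functions on $[0,1]$ with finite norm $$\|f\|_{L\log^sL}:=\inf\left\{\lambda>0:\ \int_0^1B_s\left(\frac{|f(x)|}{\lambda}\right)dx\le1\right\};$$ for $s=0$ this is $L^1([0,1])$. *)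

theory Defs
  imports "HOL-Analysis.Analysis"
begin

abbreviation unit_space :: "real measure"
  where "unit_space \<equiv> lebesgue_on {0..1}"

text \<open>Dyadic intervals are taken half-open. The point 1 lies in none of them, so all
  functions \<open>dyadic_cond_exp k f\<close> and \<open>dyadic_mart_diff k f\<close> vanish there; it is a null set.\<close>

definition dyadic_intervals :: "nat \<Rightarrow> real set set"
  where "dyadic_intervals k = (\<lambda>j::nat. {real j / 2 ^ k ..< (real j + 1) / 2 ^ k}) ` {..<2 ^ k}"

definition dyadic_cond_exp :: "nat \<Rightarrow> (real \<Rightarrow> complex) \<Rightarrow> real \<Rightarrow> complex"
  where "dyadic_cond_exp k f x =
    (\<Sum>I\<in>dyadic_intervals k.
       indicator I x *\<^sub>R ((1 / measure unit_space I) *\<^sub>R (LINT y:I|unit_space. f y)))"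

fun dyadic_mart_diff :: "nat \<Rightarrow> (real \<Rightarrow> complex) \<Rightarrow> real \<Rightarrow> complex"
  where
    "dyadic_mart_diff 0 f x = dyadic_cond_exp 0 f x"
  | "dyadic_mart_diff (Suc k) f x = dyadic_cond_exp (Suc k) f x - dyadic_cond_exp k f x"

definition Llog_young :: "real \<Rightarrow> real \<Rightarrow> real"
  where "Llog_young s t = t * (ln (exp 1 + t)) powr s"

text \<open>The norm takes values in \<^typ>\<open>ennreal\<close>: the infimum of the empty set is \<open>\<infinity>\<close>,
  so that membership in the space is measurability together with finiteness of the norm.\<close>

definition Llog_norm :: "real \<Rightarrow> (real \<Rightarrow> 'a::real_normed_vector) \<Rightarrow> ennreal"
  where "Llog_norm s f =
    Inf {ennreal l | l. l > 0 \<and>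
           (\<integral>\<^sup>+ x. ennreal (Llog_young s (norm (f x) / l)) \<partial>unit_space) \<le> 1}"

definition Llog_space :: "real \<Rightarrow> (real \<Rightarrow> 'a::real_normed_vector) set"
  where "Llog_space s = {f \<in> borel_measurable unit_space. Llog_norm s f < \<infinity>}"

end

theory Submission
  imports Defs
begin

text \<open>
  The functions \<open>f\<^sub>k\<close> can be written down explicitly, so that no duality argument is needed. Let
  \<open>h \<ge> 0\<close>, and let a dyadic interval of length \<open>2\<^sup>-\<^sup>k\<close> have halves on which \<open>h\<close> has mass \<open>a\<close> and \<open>b\<close>.
  The operator \<open>D\<^sub>k\<^sub>+\<^sub>1\<close> only sees the difference of the masses of the two halves. Multiplying \<open>h\<close>
  by \<open>(a - b) / a\<close> on the half with the larger mass \<open>a\<close>, and by \<open>0\<close> on the other half, preserves this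
  difference. The result has the form \<open>h r\<^sub>k\<close>, where \<open>0 \<le> r\<^sub>k \<le> 1\<close> is constant on cells
  (\<open>haar_coeff_gain_step\<close>).

  The weights \<open>r\<^sub>k\<close> are square summable on average because they are paid for by entropy. By strict
  convexity of \<open>t ln t\<close>, refining the partition by one generation raises the entropy
  \<open>\<integral> E\<^sub>k h ln (E\<^sub>k h)\<close> by at least \<open>\<integral> h r\<^sub>k\<^sup>2 / 8\<close> (\<open>sibling_gain_entropy\<close>, \<open>gain_step_energy\<close>).
  If \<open>h \<le> e\<^sup>L\<close> and \<open>m = \<integral> h\<close>, the total increase of the entropy is at most \<open>m (L - ln m)\<close>, so with
  \<open>S\<^sup>2 = 1 + \<Sum> r\<^sub>k\<^sup>2\<close> the integral \<open>\<integral> h S\<^sup>2\<close> is at most a multiple of \<open>L m\<close> plus a multiple of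
  \<open>e\<^sup>-\<^sup>L\<close> (\<open>total_gain_energy\<close>). Thus \<open>S\<close> is typically of size \<open>L\<^sup>1\<^sup>/\<^sup>2\<close> where \<open>h\<close> lives, and this is
  exactly the half power of the logarithm that separates the two norms.

  For a general normalised \<open>f \<ge> 0\<close> this is applied to each of its level pieces
  \<open>h\<^sub>j = f 1\<^bsub>lev = j\<^esub>\<close>, where \<open>lev = \<lfloor>ln (e + f)\<rfloor>\<close>. The pieces have disjoint supports, so the square
  function of the sum is \<open>f S\<^sub>j\<close> on \<open>{lev = j}\<close> and no triangle inequality is lost. With \<open>L = j + 1\<close> and
  \<open>s = (\<sigma> + 1) / 2\<close> the pointwise bound
  \<open>B\<^bsub>\<sigma>/2\<^esub>(f S) \<le> C L\<^sup>s f (1 + S\<^sup>2 / L)\<close> (\<open>Llog_young_level_bound\<close>) reduces everything to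
  \<open>\<Sum>\<^sub>j L\<^sup>s m\<^sub>j \<le> 2\<^sup>s \<integral> B\<^sub>s(f)\<close> and to the convergence of \<open>\<Sum>\<^sub>j L\<^sup>s\<^sup>-\<^sup>1 e\<^sup>-\<^sup>L\<close>; this is
  \<open>exists_lift_nonneg\<close>. A complex function is split into four nonnegative parts, and scaling by a
  nearly optimal \<open>\<lambda>\<close> in the Luxemburg norm gives the theorem.
\<close>

section \<open>Scalar inequalities\<close>

lemma ln_le_quadratic:
  fixes y :: real
  assumes "0 < y" "y \<le> 1"
  shows "ln y \<le> (y - 1) - (1 - y)\<^sup>2 / 2"
proof -
  define \<phi> where "\<phi> = (\<lambda>y::real. (y - 1) - (1 - y)\<^sup>2 / 2 - ln y)"
  have "\<phi> 1 \<le> \<phi> y"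
  proof (rule DERIV_nonpos_imp_nonincreasing[OF assms(2)])
    fix x assume x: "y \<le> x" "x \<le> 1"
    have "0 < x" using x assms by simp
    then have "(\<phi> has_real_derivative (1 + (1 - x) - 1 / x)) (at x)"
      unfolding \<phi>_def by (auto intro!: derivative_eq_intros simp: power2_eq_square field_simps)
    moreover have "1 + (1 - x) - 1 / x = - ((1 - x)\<^sup>2 / x)"
      using \<open>0 < x\<close> by (simp add: field_simps power2_eq_square)
    moreover have "0 \<le> (1 - x)\<^sup>2 / x" using \<open>0 < x\<close> by simp
    ultimately show "\<exists>d. (\<phi> has_real_derivative d) (at x) \<and> d \<le> 0"
      by (metis neg_le_0_iff_le)
  qed
  then show ?thesis by (simp add: \<phi>_def)
qed

text \<open>Since \<open>ln\<close> lies below its tangent at \<open>a\<close>, the constant \<open>exp (a ln a - a)\<close> works.\<close>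

lemma powr_le_exp:
  fixes a :: real
  assumes "a > 0"
  obtains C where "C > 0" "\<And>y. y > 0 \<Longrightarrow> y powr a \<le> C * exp y"
proof
  show "exp (a * ln a - a) > 0" by simp
  fix y :: real assume y: "y > 0"
  have "ln (y / a) \<le> y / a - 1" using assms y by (intro ln_le_minus_one) simp
  then have "a * ln (y / a) \<le> a * (y / a - 1)" using assms by (intro mult_left_mono) auto
  then have "a * ln y \<le> (a * ln a - a) + y"
    using assms y by (simp add: ln_div algebra_simps)
  then have "exp (a * ln y) \<le> exp ((a * ln a - a) + y)" by simp
  then show "y powr a \<le> exp (a * ln a - a) * exp y"
    using y by (simp add: powr_def exp_add[symmetric])
qed

lemma ln_e_add_ge_1: "0 \<le> (t::real) \<Longrightarrow> 1 \<le> ln (exp 1 + t)"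
  by (subst ln_ge_iff) (auto intro: add_pos_nonneg)

lemma ln_e_add_mult_le:
  fixes x y :: real
  assumes "0 \<le> x" "0 \<le> y"
  shows "ln (exp 1 + x * y) \<le> ln (exp 1 + x) + ln (exp 1 + y)"
proof -
  have "exp 1 * 1 \<le> exp 1 * (exp 1 :: real)" by (intro mult_left_mono) auto
  then have "exp 1 + x * y \<le> (exp 1 + x) * (exp 1 + y)"
    using assms by (simp add: algebra_simps add_increasing add_increasing2)
  moreover have "0 < exp 1 + x * y" using assms by (intro add_pos_nonneg) auto
  ultimately have "ln (exp 1 + x * y) \<le> ln ((exp 1 + x) * (exp 1 + y))" by simp
  also have "\<dots> = ln (exp 1 + x) + ln (exp 1 + y)"
    using assms by (intro ln_mult_pos) (auto intro: add_pos_nonneg)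
  finally show ?thesis .
qed

lemma ln_e_add_le:
  fixes x :: real
  assumes "0 \<le> x"
  shows "ln (exp 1 + x) \<le> 1 + x"
proof -
  have "1 \<le> exp (1::real)" by simp
  then have "x * 1 \<le> x * exp 1" using assms by (intro mult_left_mono) auto
  then have "exp 1 + x \<le> exp 1 * (1 + x)" by (simp add: algebra_simps)
  also have "\<dots> \<le> exp 1 * exp x" by (intro mult_left_mono exp_ge_add_one_self) auto
  finally have "exp 1 + x \<le> exp (1 + x)" by (simp add: exp_add)
  moreover have "0 < exp 1 + x" using assms by (intro add_pos_nonneg) auto
  ultimately show ?thesis by (metis ln_exp ln_le_cancel_iff exp_gt_zero)
qed

lemma Llog_young_nonneg: "0 \<le> t \<Longrightarrow> 0 \<le> Llog_young s t"
  by (simp add: Llog_young_def)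

lemma Llog_young_0 [simp]: "Llog_young s 0 = 0"
  by (simp add: Llog_young_def)

lemma Llog_young_ge_self:
  assumes "0 \<le> s" "0 \<le> t" shows "t \<le> Llog_young s t"
  unfolding Llog_young_def
  using mult_left_mono[OF ge_one_powr_ge_zero[OF ln_e_add_ge_1[OF assms(2)] assms(1)] assms(2)]
  by simp

lemma Llog_young_mono:
  assumes "0 \<le> s" "0 \<le> t" "t \<le> u" shows "Llog_young s t \<le> Llog_young s u"
proof -
  have "1 \<le> exp 1 + t" using assms one_le_exp_iff[of 1] by linarith
  then show ?thesis
    unfolding Llog_young_def using assms
    by (intro mult_mono powr_mono2) auto
qed

lemma Llog_young_scale:
  assumes "0 \<le> s" "0 \<le> t" "0 \<le> c" "c \<le> 1" shows "Llog_young s (c * t) \<le> c * Llog_young s t"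
proof -
  have ct: "0 \<le> c * t" "c * t \<le> t" using assms by (auto simp: mult_left_le_one_le)
  have "1 \<le> exp 1 + c * t" using ct one_le_exp_iff[of 1] by linarith
  then have "ln (exp 1 + c * t) powr s \<le> ln (exp 1 + t) powr s"
    using ct assms by (intro powr_mono2) auto
  then show ?thesis
    unfolding Llog_young_def using ct assms
    by (metis mult.assoc mult_left_mono)
qed

lemma Llog_young_measurable [measurable]: "Llog_young s \<in> borel_measurable borel"
  unfolding Llog_young_def by measurable

text \<open>In the application \<open>h\<close> is of size about \<open>exp L\<close> and \<open>S\<close> has size about \<open>sqrt L\<close>. Writing
  \<open>S = sqrt L * t\<close>, the logarithm of \<open>e + h S\<close> is at most \<open>4 L ln (e + t)\<close>, and
  \<open>t (ln (e + t))\<^bsup>\<sigma>/2\<^esup>\<close> is dominated by \<open>1 + t\<^sup>2\<close>. The power of \<open>L\<close> that comes out,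
  \<open>\<sigma> / 2 + 1 / 2\<close>, is where the exponent \<open>(\<sigma> + 1) / 2\<close> originates. The quadratic dependence on \<open>S\<close> is what
  the entropy estimate can control.\<close>

lemma Llog_young_level_bound:
  fixes \<sigma> :: real
  assumes "\<sigma> \<ge> 0"
  obtains C where "C > 0"
    "\<And>h L S. 0 \<le> h \<Longrightarrow> 1 \<le> L \<Longrightarrow> ln (exp 1 + h) \<le> L \<Longrightarrow> 0 \<le> S \<Longrightarrow>
      Llog_young (\<sigma> / 2) (h * S)
        \<le> C * (L powr ((\<sigma> + 1) / 2) * h + L powr ((\<sigma> + 1) / 2 - 1) * h * S\<^sup>2)"
proof -
  define a where "a = \<sigma> / 2"
  have a: "a \<ge> 0" using assms by (simp add: a_def)
  \<comment> \<open>The exponent \<open>a + 1\<close> is used because \<open>a\<close> may vanish.\<close>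
  obtain K where K: "K > 0" "\<And>y. y > 0 \<Longrightarrow> y powr (a + 1) \<le> K * exp y"
    using powr_le_exp[of "a + 1"] a by auto
  define C where "C = 4 powr a * (K * (exp 1 + 1))"
  show thesis
  proof
    show "C > 0" using K(1) by (simp add: C_def add_pos_pos)
    fix h L S :: real
    assume h: "0 \<le> h" and L: "1 \<le> L" and hL: "ln (exp 1 + h) \<le> L" and S: "0 \<le> S"
    define t where "t = S / sqrt L"
    define v where "v = ln (exp 1 + t)"
    have t: "t \<ge> 0" and St: "S = sqrt L * t" using L S by (auto simp: t_def)
    have v: "v \<ge> 1" using ln_e_add_ge_1[OF t] by (simp add: v_def)
    have sqL: "sqrt L \<le> L" using L by (intro real_le_lsqrt) (auto simp: power2_eq_square)
    have "ln (exp 1 + h * S) \<le> ln (exp 1 + h) + (ln (exp 1 + sqrt L) + v)"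
      using ln_e_add_mult_le[OF h S] ln_e_add_mult_le[of "sqrt L" t] L t
      unfolding St v_def by simp
    also have "\<dots> \<le> L + ((1 + L) + v)"
      using hL ln_e_add_le[of "sqrt L"] sqL L by simp
    also have "\<dots> \<le> 4 * (L * v)"
    proof -
      have "1 * v \<le> L * v" using L v by (intro mult_right_mono) auto
      moreover have "L * 1 \<le> L * v" using L v by (intro mult_left_mono) auto
      ultimately show ?thesis using L by linarith
    qed
    finally have le: "ln (exp 1 + h * S) \<le> 4 * (L * v)" .
    have "ln (exp 1 + h * S) powr a \<le> (4 * (L * v)) powr a"
      using le a ln_e_add_ge_1[of "h * S"] h S by (intro powr_mono2) auto
    also have "\<dots> = 4 powr a * L powr a * v powr a"
      using L v by (simp add: powr_mult)
    finally have 1: "ln (exp 1 + h * S) powr a \<le> 4 powr a * L powr a * v powr a" .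
    have "v powr a \<le> v powr (a + 1)" using v by (intro powr_mono) auto
    also have "\<dots> \<le> K * exp v" using K v by auto
    also have "exp v = exp 1 + t" using t unfolding v_def by (subst exp_ln) (auto intro: add_pos_nonneg)
    finally have 2: "v powr a \<le> K * (exp 1 + t)" .
    have tt: "t * (exp 1 + t) \<le> (exp 1 + 1) * (1 + t\<^sup>2)"
    proof -
      have "t \<le> 1 + t\<^sup>2"
        using zero_le_power2[of "t - 1"] t unfolding power2_diff by simp
      then have "exp 1 * t \<le> exp 1 * (1 + t\<^sup>2)" by (intro mult_left_mono) auto
      then show ?thesis by (simp add: algebra_simps power2_eq_square)
    qed
    have Ls: "L powr a * sqrt L = L powr ((\<sigma> + 1) / 2)"
      using L by (simp add: a_def powr_half_sqrt[symmetric] powr_add[symmetric] add_divide_distrib)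
    have t2: "L powr ((\<sigma> + 1) / 2) * t\<^sup>2 = L powr ((\<sigma> + 1) / 2 - 1) * S\<^sup>2"
      using L by (simp only: t_def power_divide powr_diff) simp
    have "Llog_young a (h * S) \<le> (h * S) * (4 powr a * L powr a * v powr a)"
      unfolding Llog_young_def using 1 h S by (intro mult_left_mono) auto
    also have "\<dots> \<le> (h * S) * (4 powr a * L powr a * (K * (exp 1 + t)))"
      using 2 h S by (intro mult_left_mono) auto
    also have "\<dots> = 4 powr a * K * h * (L powr a * sqrt L) * (t * (exp 1 + t))"
      by (simp add: St)
    also have "\<dots> \<le> 4 powr a * K * h * (L powr a * sqrt L) * ((exp 1 + 1) * (1 + t\<^sup>2))"
      using tt h K L by (intro mult_left_mono) auto
    also have "\<dots> = C * (h * (L powr ((\<sigma> + 1) / 2) + L powr ((\<sigma> + 1) / 2) * t\<^sup>2))"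
      unfolding Ls C_def by (simp add: algebra_simps)
    also have "\<dots> = C * (L powr ((\<sigma> + 1) / 2) * h + L powr ((\<sigma> + 1) / 2 - 1) * h * S\<^sup>2)"
      unfolding t2 by (simp add: algebra_simps)
    finally show "Llog_young (\<sigma> / 2) (h * S)
        \<le> C * (L powr ((\<sigma> + 1) / 2) * h + L powr ((\<sigma> + 1) / 2 - 1) * h * S\<^sup>2)"
      by (simp add: a_def)
  qed
qed

section \<open>The entropy inequality for two siblings\<close>

text \<open>The factor by which \<open>h\<close> is multiplied on a cell of mass \<open>a\<close> whose sibling has mass \<open>b\<close>. For
  \<open>a = 0\<close> division by zero gives the factor \<open>0\<close>, which is the right value there.\<close>

definition sibling_gain :: "real \<Rightarrow> real \<Rightarrow> real"
  where "sibling_gain a b = max 0 (a - b) / a"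

lemma sibling_gain_nonneg: "0 \<le> a \<Longrightarrow> 0 \<le> sibling_gain a b"
  by (simp add: sibling_gain_def)

lemma sibling_gain_le_1: "0 \<le> a \<Longrightarrow> 0 \<le> b \<Longrightarrow> sibling_gain a b \<le> 1"
  by (auto simp: sibling_gain_def divide_le_eq_1)

text \<open>The larger sibling keeps the mass \<open>\<bar>a - b\<bar>\<close> and the smaller one keeps nothing, so the difference
  of the two masses survives.\<close>

lemma sibling_gain_diff:
  assumes "0 \<le> a" "0 \<le> b"
  shows "sibling_gain a b * a - sibling_gain b a * b = a - b"
  using assms by (auto simp: sibling_gain_def max_def)

text \<open>Let \<open>a \<ge> b\<close> and \<open>m = (a + b) / 2\<close>. The left side is \<open>(a - b)\<^sup>2 / a\<close>. The right side is \<open>8\<close> times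
  \<open>a ln (a / m) + b ln (b / m)\<close>, for any normalisation \<open>c\<close>. The quadratic lower bound for
  \<open>- ln (m / a)\<close> gains \<open>(a - m)\<^sup>2 / (2 a) = (a - b)\<^sup>2 / (8 a)\<close> over the linear terms, and the linear terms
  of the two summands cancel. It is essential that the gain sits on the larger sibling: the
  analogous quantity \<open>(a - b)\<^sup>2 / b\<close> is not bounded by the entropy.\<close>

lemma sibling_gain_entropy:
  assumes "0 \<le> a" "0 \<le> b" "0 < c"
  shows "(sibling_gain a b)\<^sup>2 * a + (sibling_gain b a)\<^sup>2 * b
    \<le> 8 * (a * ln (2 * c * a) + b * ln (2 * c * b) - (a + b) * ln (c * (a + b)))"
proof -
  have ordered: "(sibling_gain a b)\<^sup>2 * a + (sibling_gain b a)\<^sup>2 * b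
    \<le> 8 * (a * ln (2 * c * a) + b * ln (2 * c * b) - (a + b) * ln (c * (a + b)))"
    if ab: "b \<le> a" "0 < a" "0 \<le> b" for a b
  proof -
    define m where "m = (a + b) / 2"
    have m: "0 < m" "m \<le> a" "b \<le> m" using ab by (auto simp: m_def)
    have "ln (m / a) \<le> (m / a - 1) - (1 - m / a)\<^sup>2 / 2"
      using m ab by (intro ln_le_quadratic) auto
    then have "a * (ln m - ln a) \<le> a * ((m / a - 1) - (1 - m / a)\<^sup>2 / 2)"
      using m ab by (intro mult_left_mono) (auto simp: ln_div)
    also have "\<dots> = m - a - (a - m)\<^sup>2 / (2 * a)"
      using ab by (simp add: field_simps power2_eq_square)
    finally have 1: "a * (ln m - ln a) \<le> m - a - (a - m)\<^sup>2 / (2 * a)" .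
    have 2: "b * (ln m - ln b) \<le> m - b"
    proof (cases "b = 0")
      case False
      then have "ln (m / b) \<le> m / b - 1" using m ab by (intro ln_le_minus_one) auto
      then have "b * (ln m - ln b) \<le> b * (m / b - 1)"
        using m ab False by (intro mult_left_mono) (auto simp: ln_div)
      then show ?thesis using False by (simp add: algebra_simps)
    qed (use m in auto)
    have A: "a * ln (2 * c * a) = a * ln (2 * c) + a * ln a"
      using ab assms(3) by (simp add: ln_mult_pos algebra_simps)
    have B: "b * ln (2 * c * b) = b * ln (2 * c) + b * ln b"
      using ab assms(3) by (cases "b = 0") (auto simp: ln_mult_pos algebra_simps)
    have "c * (a + b) = (2 * c) * m" by (simp add: m_def)
    then have M: "ln (c * (a + b)) = ln (2 * c) + ln m"
      using m assms(3) by (simp add: ln_mult_pos)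
    have "(a * ln (2 * c * a) + b * ln (2 * c * b) - (a + b) * ln (c * (a + b)))
        = - (a * (ln m - ln a)) - (b * (ln m - ln b))"
      unfolding A B M by (simp add: algebra_simps)
    also have "\<dots> \<ge> (a - m)\<^sup>2 / (2 * a)"
      using 1 2 field_sum_of_halves[of "a + b"] unfolding m_def by linarith
    also have "(a - m)\<^sup>2 / (2 * a) = (a - b)\<^sup>2 / a / 8"
      using ab by (simp add: m_def field_simps power2_eq_square)
    finally have "(a - b)\<^sup>2 / a
        \<le> 8 * (a * ln (2 * c * a) + b * ln (2 * c * b) - (a + b) * ln (c * (a + b)))" by simp
    moreover have "(sibling_gain a b)\<^sup>2 * a + (sibling_gain b a)\<^sup>2 * b = (a - b)\<^sup>2 / a"
      using ab by (simp add: sibling_gain_def max_def power2_eq_square field_simps)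
    ultimately show ?thesis by simp
  qed
  consider "a = 0" "b = 0" | "b \<le> a" "0 < a" | "a \<le> b" "0 < b" using assms by linarith
  then show ?thesis
  proof cases
    case 1 then show ?thesis by simp
  next
    case 2 then show ?thesis using ordered[of b a] assms by simp
  next
    case 3 then show ?thesis using ordered[of a b] assms by (simp add: add.commute)
  qed
qed

section \<open>Dyadic cells and Haar coefficients\<close>

definition dyadic_cell :: "nat \<Rightarrow> nat \<Rightarrow> real set"
  where "dyadic_cell k i = {real i / 2 ^ k ..< (real i + 1) / 2 ^ k}"

text \<open>Up to normalisation the Haar function of the \<open>i\<close>-th cell of generation \<open>k\<close>; its values are
  \<open>1\<close> on the left and \<open>-1\<close> on the right half.\<close>

definition haar :: "nat \<Rightarrow> nat \<Rightarrow> real \<Rightarrow> real"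
  where "haar k i x =
    indicator (dyadic_cell (Suc k) (2 * i)) x - indicator (dyadic_cell (Suc k) (2 * i + 1)) x"

definition dyadic_step :: "nat \<Rightarrow> (nat \<Rightarrow> real) \<Rightarrow> real \<Rightarrow> real"
  where "dyadic_step k c x = (\<Sum>i<2 ^ k. indicator (dyadic_cell k i) x * c i)"

definition cell_mass :: "nat \<Rightarrow> (real \<Rightarrow> real) \<Rightarrow> nat \<Rightarrow> real"
  where "cell_mass k h i = (LINT y|unit_space. indicator (dyadic_cell k i) y * h y)"

lemma mem_dyadic_cell_iff: "x \<in> dyadic_cell k i \<longleftrightarrow> \<lfloor>x * 2 ^ k\<rfloor> = int i"
  by (auto simp: dyadic_cell_def floor_eq_iff field_simps)

lemma dyadic_cell_unique: "x \<in> dyadic_cell k i \<Longrightarrow> x \<in> dyadic_cell k j \<Longrightarrow> i = j"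
  by (simp add: mem_dyadic_cell_iff)

lemma dyadic_cell_in_sets [measurable]: "dyadic_cell k i \<in> sets borel"
  by (simp add: dyadic_cell_def)

lemma dyadic_cell_subset:
  assumes "i < 2 ^ k" shows "dyadic_cell k i \<subseteq> {0..1}"
proof -
  have "real i + 1 \<le> 2 ^ k" using assms
    by (metis Suc_leI of_nat_Suc of_nat_le_iff of_nat_numeral of_nat_power add.commute)
  then have "(real i + 1) / 2 ^ k \<le> 1" "0 \<le> real i / 2 ^ k" by simp_all
  then show ?thesis unfolding dyadic_cell_def
    by (intro subsetI) (simp only: atLeastAtMost_iff atLeastLessThan_iff, linarith)
qed

lemma dyadic_cell_split:
  "dyadic_cell k i = dyadic_cell (Suc k) (2 * i) \<union> dyadic_cell (Suc k) (2 * i + 1)"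
proof -
  have "real i / 2 ^ k = real (2 * i) / 2 ^ Suc k"
    "(real (2 * i) + 1) / 2 ^ Suc k = real (2 * i + 1) / 2 ^ Suc k"
    "(real i + 1) / 2 ^ k = (real (2 * i + 1) + 1) / 2 ^ Suc k"
    by (auto simp: field_simps)
  then show ?thesis
    unfolding dyadic_cell_def by (simp only:) (rule ivl_disj_un_two(3)[symmetric]; intro divide_right_mono; simp)
qed

lemma indicator_dyadic_cell_split:
  "indicator (dyadic_cell k i) x =
    (indicator (dyadic_cell (Suc k) (2 * i)) x + indicator (dyadic_cell (Suc k) (2 * i + 1)) x :: real)"
  using dyadic_cell_unique[of x "Suc k" "2 * i" "2 * i + 1"]
  by (auto simp: dyadic_cell_split[of k i] indicator_def)

lemma measurable_borel_unit_space:
  "f \<in> borel_measurable borel \<Longrightarrow> f \<in> borel_measurable unit_space"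
  by (intro measurable_restrict_space1 measurable_completion) simp

lemma indicator_dyadic_cell_measurable [measurable]:
  "(indicator (dyadic_cell k i) :: real \<Rightarrow> real) \<in> borel_measurable unit_space"
  by (intro measurable_borel_unit_space) simp

lemma haar_measurable [measurable]: "haar k i \<in> borel_measurable unit_space"
  unfolding haar_def by measurable

lemma dyadic_step_measurable [measurable]: "dyadic_step k c \<in> borel_measurable unit_space"
  unfolding dyadic_step_def by measurable

lemma sum_lessThan_double: "(\<Sum>i<2 ^ Suc k. F i) = (\<Sum>i<2 ^ k. F (2 * i) + F (2 * i + 1))"
  for F :: "nat \<Rightarrow> 'a::comm_monoid_add"
proof -
  have "(\<Sum>i<2 * n. F i) = (\<Sum>i<n. F (2 * i) + F (2 * i + 1))" for n
    by (induction n) (auto simp: add.assoc)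
  then show ?thesis by simp
qed

lemma dyadic_step_eq:
  assumes "x \<in> dyadic_cell k i" "i < 2 ^ k" shows "dyadic_step k c x = c i"
proof -
  have "dyadic_step k c x = (\<Sum>j<2 ^ k. if j = i then c j else 0)"
    unfolding dyadic_step_def
  proof (intro sum.cong refl)
    fix j
    have "x \<in> dyadic_cell k j \<longleftrightarrow> j = i" using dyadic_cell_unique[OF assms(1), of j] assms(1) by blast
    then show "indicator (dyadic_cell k j) x * c j = (if j = i then c j else 0)"
      by (simp add: indicator_def)
  qed
  then show ?thesis using assms(2) by simp
qed

lemma dyadic_step_cases:
  obtains (cell) i where "i < 2 ^ k" "x \<in> dyadic_cell k i" | (outside) "\<And>c. dyadic_step k c x = 0"
proof (cases "\<exists>i<2 ^ k. x \<in> dyadic_cell k i")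
  case False
  then show ?thesis by (intro outside) (auto simp: dyadic_step_def intro!: sum.neutral)
qed (use cell in auto)

lemma dyadic_step_bounds:
  assumes "\<And>i. 0 \<le> c i" "\<And>i. c i \<le> 1"
  shows "0 \<le> dyadic_step k c x" "dyadic_step k c x \<le> 1"
  using assms by (cases rule: dyadic_step_cases[of k x]; simp add: dyadic_step_eq)+

lemma dyadic_step_power2: "(dyadic_step k c x)\<^sup>2 = dyadic_step k (\<lambda>i. (c i)\<^sup>2) x"
  by (cases rule: dyadic_step_cases[of k x]) (auto simp: dyadic_step_eq)

lemma integrable_bounded_mult:
  fixes u :: "real \<Rightarrow> 'a::{banach, second_countable_topology}"
  assumes "integrable M u" "w \<in> borel_measurable M" "\<And>x. \<bar>w x\<bar> \<le> 1"
  shows "integrable M (\<lambda>x. w x *\<^sub>R u x)"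
  using assms by (intro Bochner_Integration.integrable_bound[OF assms(1)])
    (auto simp: mult_left_le_one_le)

lemma abs_haar_le_1: "\<bar>haar k i x\<bar> \<le> 1"
  by (auto simp: haar_def indicator_def)

lemma integrable_indicator_cell_mult:
  fixes u :: "real \<Rightarrow> 'a::{banach, second_countable_topology}"
  assumes "integrable unit_space u"
  shows "integrable unit_space (\<lambda>x. indicator (dyadic_cell k i) x *\<^sub>R u x)"
  using assms by (rule integrable_bounded_mult[OF _ indicator_dyadic_cell_measurable]) (simp add: indicator_def)

lemma integrable_haar_mult:
  fixes u :: "real \<Rightarrow> 'a::{banach, second_countable_topology}"
  assumes "integrable unit_space u"
  shows "integrable unit_space (\<lambda>x. haar k i x *\<^sub>R u x)"
  using assms by (rule integrable_bounded_mult) (auto simp: abs_haar_le_1)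

lemma measure_dyadic_cell:
  assumes "i < 2 ^ k" shows "measure unit_space (dyadic_cell k i) = 1 / 2 ^ k"
proof -
  have "measure unit_space (dyadic_cell k i) = measure lebesgue (dyadic_cell k i)"
    using dyadic_cell_subset[OF assms] by (intro measure_restrict_space) auto
  also have "\<dots> = measure lborel (dyadic_cell k i)" by simp
  also have "\<dots> = 1 / 2 ^ k"
    by (simp add: dyadic_cell_def divide_right_mono diff_divide_distrib[symmetric])
  finally show ?thesis .
qed

lemma dyadic_cond_exp_eq:
  "dyadic_cond_exp k u x = (\<Sum>i<2 ^ k. (indicator (dyadic_cell k i) x * 2 ^ k) *\<^sub>R
      (LINT y|unit_space. indicator (dyadic_cell k i) y *\<^sub>R u y))"
proof -
  have inj: "inj_on (dyadic_cell k) {..<2 ^ k}"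
  proof (rule inj_onI)
    fix i j assume "dyadic_cell k i = dyadic_cell k j"
    moreover have "real i / 2 ^ k \<in> dyadic_cell k i" by (simp add: dyadic_cell_def divide_strict_right_mono)
    ultimately show "i = j" by (metis dyadic_cell_unique)
  qed
  have "dyadic_intervals k = dyadic_cell k ` {..<2 ^ k}"
    by (simp add: dyadic_intervals_def dyadic_cell_def)
  then show ?thesis
    unfolding dyadic_cond_exp_def
    by (auto simp: sum.reindex[OF inj] measure_dyadic_cell set_lebesgue_integral_def intro!: sum.cong)
qed

text \<open>This is the Haar expansion of the martingale difference. It turns the requirement
  \<open>D\<^sub>k f = D\<^sub>k f\<^sub>k\<close> into the equality of finitely many integrals, which is linear in the function.\<close>

lemma dyadic_mart_diff_Suc_eq_haar:
  assumes u: "integrable unit_space u"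
  shows "dyadic_mart_diff (Suc k) u x =
    (\<Sum>i<2 ^ k. (2 ^ k * haar k i x) *\<^sub>R (LINT y|unit_space. haar k i y *\<^sub>R u y))"
proof -
  define I where "I = (\<lambda>i. LINT y|unit_space. indicator (dyadic_cell (Suc k) i) y *\<^sub>R u y)"
  define p :: "nat \<Rightarrow> real" where "p = (\<lambda>i. indicator (dyadic_cell (Suc k) i) x)"
  note int = integrable_indicator_cell_mult[OF u]
  have 1: "(LINT y|unit_space. indicator (dyadic_cell k i) y *\<^sub>R u y) = I (2 * i) + I (2 * i + 1)" for i
    unfolding indicator_dyadic_cell_split[of k] I_def scaleR_add_left
    by (intro Bochner_Integration.integral_add int)
  have 2: "(LINT y|unit_space. haar k i y *\<^sub>R u y) = I (2 * i) - I (2 * i + 1)" for i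
    unfolding haar_def I_def scaleR_diff_left
    by (intro Bochner_Integration.integral_diff int)
  have 3: "dyadic_cond_exp (Suc k) u x =
    (\<Sum>i<2 ^ k. (p (2 * i) * 2 ^ Suc k) *\<^sub>R I (2 * i) + (p (2 * i + 1) * 2 ^ Suc k) *\<^sub>R I (2 * i + 1))"
    unfolding dyadic_cond_exp_eq I_def p_def by (rule sum_lessThan_double)
  have 4: "dyadic_cond_exp k u x =
    (\<Sum>i<2 ^ k. ((p (2 * i) + p (2 * i + 1)) * 2 ^ k) *\<^sub>R (I (2 * i) + I (2 * i + 1)))"
    unfolding dyadic_cond_exp_eq 1 by (simp only: indicator_dyadic_cell_split[of k _ x] p_def)
  \<comment> \<open>With \<open>a, b\<close> the indicators of the two halves and \<open>v, w\<close> the integrals over them, this is the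
    contribution of one parent cell.\<close>
  have 5: "(a * (2 * c)) *\<^sub>R v + (b * (2 * c)) *\<^sub>R w - ((a + b) * c) *\<^sub>R (v + w)
      = (c * (a - b)) *\<^sub>R (v - w)" for a b c :: real and v w :: complex
    by (simp add: complex_eq_iff algebra_simps)
  have "dyadic_mart_diff (Suc k) u x
      = (\<Sum>i<2 ^ k. (2 ^ k * (p (2 * i) - p (2 * i + 1))) *\<^sub>R (I (2 * i) - I (2 * i + 1)))"
    unfolding dyadic_mart_diff.simps 3 4 sum_subtractf[symmetric] power_Suc 5 by (rule refl)
  then show ?thesis unfolding 2 by (simp add: haar_def p_def)
qed

section \<open>The energy of the redistributed martingale differences\<close>

text \<open>Cells \<open>2 i\<close> and \<open>2 i + 1\<close> of one generation are the halves of cell \<open>i\<close> of the previous one.\<close>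

definition sibling :: "nat \<Rightarrow> nat"
  where "sibling i = (if even i then i + 1 else i - 1)"

text \<open>\<open>h * gain_step h k\<close> will replace \<open>h\<close> in the martingale difference of index \<open>k + 1\<close>, hence
  the generation \<open>Suc k\<close> on the right.\<close>

definition gain_step :: "(real \<Rightarrow> real) \<Rightarrow> nat \<Rightarrow> real \<Rightarrow> real"
  where "gain_step h k = dyadic_step (Suc k)
    (\<lambda>i. sibling_gain (cell_mass (Suc k) h i) (cell_mass (Suc k) h (sibling i)))"

lemma sibling_simps [simp]: "sibling (2 * i) = 2 * i + 1" "sibling (2 * i + 1) = 2 * i"
  "sibling (Suc (2 * i)) = 2 * i"
  by (auto simp: sibling_def)

lemma cell_mass_nonneg: "(\<And>x. 0 \<le> h x) \<Longrightarrow> 0 \<le> cell_mass k h i"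
  unfolding cell_mass_def by (intro Bochner_Integration.integral_nonneg) auto

lemma cell_mass_split:
  assumes "integrable unit_space h"
  shows "cell_mass k h i = cell_mass (Suc k) h (2 * i) + cell_mass (Suc k) h (2 * i + 1)"
  unfolding cell_mass_def indicator_dyadic_cell_split[of k] distrib_right
  using integrable_indicator_cell_mult[OF assms]
  by (intro Bochner_Integration.integral_add) auto

text \<open>The only cell of generation \<open>0\<close> is \<open>[0, 1)\<close>, which misses just a null set of the unit interval.\<close>

lemma cell_mass_0_0:
  assumes "integrable unit_space h"
  shows "cell_mass 0 h 0 = (LINT x|unit_space. h x)"
proof -
  have "AE x in unit_space. x \<noteq> 1"
    using AE_completion[OF AE_lborel_singleton[of "1::real"]]
    by (subst AE_restrict_space_iff) (auto elim: eventually_mono)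
  show ?thesis
    unfolding cell_mass_def
  proof (intro integral_cong_AE)
    show "AE x in unit_space. indicator (dyadic_cell 0 0) x * h x = h x"
      using \<open>AE x in unit_space. x \<noteq> 1\<close>
      by (rule AE_mp) (intro AE_I2 impI, simp add: dyadic_cell_def)
  qed (use assms integrable_indicator_cell_mult[OF assms, of 0 0] in
    \<open>simp_all add: borel_measurable_integrable\<close>)
qed

lemma sum_cell_mass:
  assumes "integrable unit_space h"
  shows "(\<Sum>i<2 ^ k. cell_mass k h i) = (LINT x|unit_space. h x)"
proof (induction k)
  case (Suc k)
  show ?case unfolding sum_lessThan_double cell_mass_split[OF assms, of k, symmetric] by (rule Suc)
qed (simp add: cell_mass_0_0[OF assms])

lemma integral_mult_dyadic_step:
  assumes "integrable unit_space h"
  shows "(LINT x|unit_space. h x * dyadic_step k c x) = (\<Sum>i<2 ^ k. c i * cell_mass k h i)"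
proof -
  have "(LINT x|unit_space. h x * dyadic_step k c x)
      = (LINT x|unit_space. (\<Sum>i<2 ^ k. c i * (indicator (dyadic_cell k i) x * h x)))"
    unfolding dyadic_step_def sum_distrib_left by (simp only: mult_ac)
  also have "\<dots> = (\<Sum>i<2 ^ k. c i * cell_mass k h i)"
    unfolding cell_mass_def using integrable_indicator_cell_mult[OF assms]
    by (subst Bochner_Integration.integral_sum) auto
  finally show ?thesis .
qed

lemma gain_step_bounds:
  assumes "\<And>x. 0 \<le> h x"
  shows "0 \<le> gain_step h k x" "gain_step h k x \<le> 1"
  unfolding gain_step_def
  by (intro dyadic_step_bounds sibling_gain_nonneg sibling_gain_le_1 cell_mass_nonneg assms)+

lemma haar_coeff_gain_step:
  assumes h: "integrable unit_space h" "\<And>x. 0 \<le> h x" and i: "i < 2 ^ k"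
  shows "(LINT x|unit_space. haar k i x * (h x * gain_step h k x)) = (LINT x|unit_space. haar k i x * h x)"
proof -
  define a where "a = cell_mass (Suc k) h (2 * i)"
  define b where "b = cell_mass (Suc k) h (2 * i + 1)"
  have ab: "0 \<le> a" "0 \<le> b" by (auto simp: a_def b_def cell_mass_nonneg h)
  let ?p = "\<lambda>x. indicator (dyadic_cell (Suc k) (2 * i)) x :: real"
  let ?q = "\<lambda>x. indicator (dyadic_cell (Suc k) (2 * i + 1)) x :: real"
  note int = integrable_indicator_cell_mult[OF h(1), unfolded real_scaleR_def]
  have p: "?p x * gain_step h k x = sibling_gain a b * ?p x" for x
    using i by (cases "x \<in> dyadic_cell (Suc k) (2 * i)")
      (auto simp: gain_step_def dyadic_step_eq a_def b_def)
  have q: "?q x * gain_step h k x = sibling_gain b a * ?q x" for x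
    using i by (cases "x \<in> dyadic_cell (Suc k) (2 * i + 1)")
      (auto simp: gain_step_def dyadic_step_eq a_def b_def)
  have "haar k i x * (h x * gain_step h k x)
      = sibling_gain a b * (?p x * h x) - sibling_gain b a * (?q x * h x)" for x
  proof -
    have "haar k i x * (h x * gain_step h k x)
        = (?p x * gain_step h k x) * h x - (?q x * gain_step h k x) * h x"
      by (simp add: haar_def algebra_simps)
    then show ?thesis unfolding p q by (simp add: mult_ac)
  qed
  then have "(LINT x|unit_space. haar k i x * (h x * gain_step h k x))
      = sibling_gain a b * a - sibling_gain b a * b"
    using int by (simp add: a_def b_def cell_mass_def)
  also have "\<dots> = a - b" by (rule sibling_gain_diff[OF ab])
  also have "\<dots> = (LINT x|unit_space. haar k i x * h x)"
    using int by (simp add: haar_def left_diff_distrib a_def b_def cell_mass_def)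
  finally show ?thesis .
qed

text \<open>Since \<open>2 ^ k * cell_mass k h i\<close> is the average of \<open>h\<close> over a cell, this is the integral of
  \<open>E\<^sub>k h ln (E\<^sub>k h)\<close>.\<close>

definition dyadic_entropy :: "(real \<Rightarrow> real) \<Rightarrow> nat \<Rightarrow> real"
  where "dyadic_entropy h k = (\<Sum>i<2 ^ k. cell_mass k h i * ln (2 ^ k * cell_mass k h i))"

lemma gain_step_energy:
  assumes h: "integrable unit_space h" "\<And>x. 0 \<le> h x"
  shows "(LINT x|unit_space. h x * (gain_step h k x)\<^sup>2)
    \<le> 8 * (dyadic_entropy h (Suc k) - dyadic_entropy h k)"
proof -
  let ?m = "cell_mass (Suc k) h"
  have "(LINT x|unit_space. h x * (gain_step h k x)\<^sup>2)
      = (\<Sum>i<2 ^ k. (sibling_gain (?m (2 * i)) (?m (2 * i + 1)))\<^sup>2 * ?m (2 * i) +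
          (sibling_gain (?m (2 * i + 1)) (?m (2 * i)))\<^sup>2 * ?m (2 * i + 1))"
    unfolding gain_step_def dyadic_step_power2 integral_mult_dyadic_step[OF h(1)] sum_lessThan_double
    by simp
  also have "\<dots> \<le> (\<Sum>i<2 ^ k. 8 * (?m (2 * i) * ln (2 * 2 ^ k * ?m (2 * i)) +
      ?m (2 * i + 1) * ln (2 * 2 ^ k * ?m (2 * i + 1)) -
      (?m (2 * i) + ?m (2 * i + 1)) * ln (2 ^ k * (?m (2 * i) + ?m (2 * i + 1)))))"
    by (intro sum_mono sibling_gain_entropy cell_mass_nonneg h) simp
  also have "\<dots> = 8 * (dyadic_entropy h (Suc k) - dyadic_entropy h k)"
    unfolding dyadic_entropy_def sum_lessThan_double cell_mass_split[OF h(1), of k]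
    by (simp add: sum_subtractf sum_distrib_left)
  finally show ?thesis .
qed

lemma dyadic_entropy_le:
  assumes h: "integrable unit_space h" "\<And>x. 0 \<le> h x" "\<And>x. h x \<le> A" and A: "0 < A"
  shows "dyadic_entropy h k \<le> (LINT x|unit_space. h x) * ln A"
proof -
  have "cell_mass k h i * ln (2 ^ k * cell_mass k h i) \<le> cell_mass k h i * ln A" if i: "i < 2 ^ k" for i
  proof (cases "cell_mass k h i = 0")
    case False
    then have pos: "0 < cell_mass k h i" using cell_mass_nonneg[of h k i] h by simp
    have "finite_measure unit_space"
      by (rule finite_measureI) (simp add: emeasure_restrict_space space_restrict_space)
    then interpret finite_measure unit_space .
    have [measurable]: "dyadic_cell k i \<in> sets unit_space"
      using dyadic_cell_subset[OF i] by (auto simp: sets_restrict_space_iff)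
    have "cell_mass k h i \<le> (LINT y|unit_space. indicator (dyadic_cell k i) y * A)"
      unfolding cell_mass_def
      using integrable_indicator_cell_mult[OF h(1)] integrable_indicator_cell_mult[of "\<lambda>_. A"] h
      unfolding real_scaleR_def by (intro integral_mono mult_left_mono) auto
    also have "\<dots> = A / 2 ^ k"
      using measure_dyadic_cell[OF i] by (simp add: inf.absorb1 dyadic_cell_subset i space_restrict_space)
    finally have "2 ^ k * cell_mass k h i \<le> A" by (simp add: field_simps)
    moreover have "0 < 2 ^ k * cell_mass k h i" using pos by simp
    ultimately show ?thesis using pos A by (intro mult_left_mono) auto
  qed simp
  then show ?thesis
    unfolding dyadic_entropy_def sum_cell_mass[OF h(1), symmetric, of k] sum_distrib_right
    by (intro sum_mono) auto
qed

text \<open>The entropy increments telescope. The final entropy is at most \<open>m L\<close>, and the initial one is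
  \<open>m ln m\<close>. The summand \<open>8 exp (- L)\<close> accounts for pieces of very small mass \<open>m\<close>, for which \<open>- ln m\<close>
  exceeds \<open>L\<close>.\<close>

lemma total_gain_energy:
  assumes h: "integrable unit_space h" "\<And>x. 0 \<le> h x" "\<And>x. h x \<le> exp L"
  shows "(\<integral>\<^sup>+ x. ennreal (h x) * (1 + (\<Sum>k. ennreal ((gain_step h k x)\<^sup>2))) \<partial>unit_space)
    \<le> ennreal ((1 + 16 * L) * (LINT x|unit_space. h x) + 8 * exp (- L))"
proof -
  define m where "m = (LINT x|unit_space. h x)"
  have [measurable]: "h \<in> borel_measurable unit_space" using h by simp
  have gm [measurable]: "gain_step h k \<in> borel_measurable unit_space" for k
    unfolding gain_step_def by measurable
  have m: "0 \<le> m" unfolding m_def using h by (intro Bochner_Integration.integral_nonneg) auto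
  have int: "integrable unit_space (\<lambda>x. h x * (gain_step h k x)\<^sup>2)" for k
  proof -
    have "\<bar>(gain_step h k x)\<^sup>2\<bar> \<le> 1" for x
      using gain_step_bounds[of h k x, OF h(2)] by (simp add: power_le_one)
    then have "integrable unit_space (\<lambda>x. (gain_step h k x)\<^sup>2 *\<^sub>R h x)"
      by (intro integrable_bounded_mult h(1)) measurable
    then show ?thesis by (simp add: mult.commute)
  qed
  \<comment> \<open>Compare \<open>m\<close> with \<open>exp (- L)\<close>: \<open>- ln m = L + ln (exp (- L) / m)\<close>, and \<open>ln y \<le> y\<close>.\<close>
  have mL: "m * (L - ln m) \<le> 2 * (m * L) + exp (- L)"
  proof (cases "m = 0")
    case False
    then have "m * (ln (exp (- L) / m)) \<le> m * (exp (- L) / m)"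
      using m by (intro mult_left_mono order_trans[OF ln_le_minus_one]) auto
    then show ?thesis using False m by (simp add: ln_div algebra_simps)
  qed simp
  have partial: "(\<Sum>k<n. LINT x|unit_space. h x * (gain_step h k x)\<^sup>2) \<le> 8 * (2 * (m * L) + exp (- L))" for n
  proof -
    have "(\<Sum>k<n. LINT x|unit_space. h x * (gain_step h k x)\<^sup>2)
        \<le> (\<Sum>k<n. 8 * (dyadic_entropy h (Suc k) - dyadic_entropy h k))"
      by (intro sum_mono gain_step_energy h)
    also have "\<dots> = 8 * (dyadic_entropy h n - dyadic_entropy h 0)"
      unfolding sum_distrib_left[symmetric] sum_lessThan_telescope ..
    also have "\<dots> \<le> 8 * (m * L - m * ln m)"
    proof -
      have "dyadic_entropy h 0 = m * ln m"
        by (simp add: dyadic_entropy_def cell_mass_0_0[OF h(1)] m_def)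
      moreover have "dyadic_entropy h n \<le> m * L"
        using dyadic_entropy_le[OF h] by (simp add: m_def)
      ultimately show ?thesis by simp
    qed
    also have "\<dots> \<le> 8 * (2 * (m * L) + exp (- L))"
      using mL unfolding right_diff_distrib[of m] by (rule mult_left_mono) simp
    finally show ?thesis .
  qed
  have "(\<integral>\<^sup>+ x. ennreal (h x) * (1 + (\<Sum>k. ennreal ((gain_step h k x)\<^sup>2))) \<partial>unit_space)
      = (\<integral>\<^sup>+ x. ennreal (h x) + (\<Sum>k. ennreal (h x * (gain_step h k x)\<^sup>2)) \<partial>unit_space)"
    unfolding distrib_left ennreal_suminf_cmult[symmetric] mult_1_right ennreal_mult'[OF h(2), symmetric] ..
  also have "\<dots> = ennreal m + (\<Sum>k. ennreal (LINT x|unit_space. h x * (gain_step h k x)\<^sup>2))"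
  proof -
    have "(\<integral>\<^sup>+ x. ennreal (h x) \<partial>unit_space) = ennreal m"
      unfolding m_def using h by (intro nn_integral_eq_integral) auto
    moreover have "(\<integral>\<^sup>+ x. ennreal (h x * (gain_step h k x)\<^sup>2) \<partial>unit_space)
        = ennreal (LINT x|unit_space. h x * (gain_step h k x)\<^sup>2)" for k
      using h by (intro nn_integral_eq_integral int) auto
    moreover have "(\<integral>\<^sup>+ x. (\<Sum>k. ennreal (h x * (gain_step h k x)\<^sup>2)) \<partial>unit_space)
        = (\<Sum>k. \<integral>\<^sup>+ x. ennreal (h x * (gain_step h k x)\<^sup>2) \<partial>unit_space)"
      by (rule nn_integral_suminf) measurable
    moreover have "(\<integral>\<^sup>+ x. ennreal (h x) + (\<Sum>k. ennreal (h x * (gain_step h k x)\<^sup>2)) \<partial>unit_space)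
        = (\<integral>\<^sup>+ x. ennreal (h x) \<partial>unit_space)
          + (\<integral>\<^sup>+ x. (\<Sum>k. ennreal (h x * (gain_step h k x)\<^sup>2)) \<partial>unit_space)"
      by (rule nn_integral_add) measurable
    ultimately show ?thesis by (simp only:)
  qed
  also have "\<dots> \<le> ennreal m + ennreal (8 * (2 * (m * L) + exp (- L)))"
  proof (rule add_left_mono[OF suminf_le_const])
    fix n
    have "(\<Sum>k<n. ennreal (LINT x|unit_space. h x * (gain_step h k x)\<^sup>2))
        = ennreal (\<Sum>k<n. LINT x|unit_space. h x * (gain_step h k x)\<^sup>2)"
      using h by (intro sum_ennreal Bochner_Integration.integral_nonneg) auto
    also have "\<dots> \<le> ennreal (8 * (2 * (m * L) + exp (- L)))" using partial by (rule ennreal_leI)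
    finally show "(\<Sum>k<n. ennreal (LINT x|unit_space. h x * (gain_step h k x)\<^sup>2)) \<le> \<dots>" .
  qed simp
  also have "ennreal m + ennreal (8 * (2 * (m * L) + exp (- L))) = ennreal (m + 8 * (2 * (m * L) + exp (- L)))"
    using m partial[of 0] by (intro ennreal_plus[symmetric]) auto
  also have "m + 8 * (2 * (m * L) + exp (- L)) = (1 + 16 * L) * m + 8 * exp (- L)"
    by (simp add: distrib_right)
  finally have bound: "(\<integral>\<^sup>+ x. ennreal (h x) * (1 + (\<Sum>k. ennreal ((gain_step h k x)\<^sup>2))) \<partial>unit_space)
    \<le> ennreal ((1 + 16 * L) * m + 8 * exp (- L))" .
  show ?thesis by (rule bound[unfolded m_def])
qed

section \<open>Lifting a nonnegative function\<close>

text \<open>The weights depend on the level of \<open>f\<close>, and there are infinitely many levels. This allows Haar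
  coefficients to be compared one level at a time.\<close>

lemma integral_eq_by_levels:
  fixes u v :: "'a \<Rightarrow> real" and lev :: "'a \<Rightarrow> nat"
  assumes int: "integrable M u" "integrable M v"
    and lev [measurable]: "lev \<in> measurable M (count_space UNIV)"
    and eq: "\<And>j. (LINT x|M. (if lev x = j then u x else 0)) = (LINT x|M. (if lev x = j then v x else 0))"
  shows "integral\<^sup>L M u = integral\<^sup>L M v"
proof -
  define A where "A j = lev -` {j} \<inter> space M" for j
  have A [measurable]: "A j \<in> sets M" for j unfolding A_def by measurable
  have sp: "(\<Union>j. A j) = space M" by (auto simp: A_def)
  have levels: "integral\<^sup>L M w = (\<Sum>j. LINT x|M. (if lev x = j then w x else 0))"
    if w: "integrable M w" for w :: "'a \<Rightarrow> real"
  proof -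
    have "integral\<^sup>L M w = (LINT x:(\<Union>j. A j)|M. w x)"
      unfolding sp set_lebesgue_integral_def
      by (intro Bochner_Integration.integral_cong) auto
    also have "\<dots> = (\<Sum>j. LINT x:A j|M. w x)"
    proof (rule lebesgue_integral_countable_add)
      show "set_integrable M (\<Union>j. A j) w"
        unfolding sp set_integrable_def by (rule integrable_mult_indicator[OF sets.top w])
    qed (auto simp: A_def)
    also have "\<dots> = (\<Sum>j. LINT x|M. (if lev x = j then w x else 0))"
      unfolding set_lebesgue_integral_def
      by (intro suminf_cong Bochner_Integration.integral_cong) (auto simp: A_def indicator_def)
    finally show ?thesis .
  qed
  show ?thesis unfolding levels[OF int(1)] levels[OF int(2)] eq ..
qed

lemma suminf_single_ennreal: "(\<Sum>j. if j = i then c j else 0) = (c i :: ennreal)"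
  using sums_single[of i c] by (simp add: sums_iff)

text \<open>Fix a point \<open>x\<close> and let \<open>h = f x\<close>, with \<open>r k\<close> and \<open>G k\<close> the values there of the weights and of the
  lifted functions. Then \<open>\<Sum> G\<^sub>k\<^sup>2 = h\<^sup>2 S\<^sup>2\<close> with \<open>S\<^sup>2 = 1 + \<Sum> r\<^sub>k\<^sup>2\<close>, the summand \<open>1\<close> being due to
  \<open>G 0 = h\<close>. The estimate is stated in \<^typ>\<open>ennreal\<close> so that it covers divergent \<open>\<Sum> r\<^sub>k\<^sup>2\<close>: for \<open>h > 0\<close> the
  right side is then infinite, and for \<open>h = 0\<close> both sides vanish.\<close>

lemma level_square_function_bound:
  assumes C: "C > 0"
    "\<And>h L S. 0 \<le> h \<Longrightarrow> 1 \<le> L \<Longrightarrow> ln (exp 1 + h) \<le> L \<Longrightarrow> 0 \<le> S \<Longrightarrow>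
      Llog_young a (h * S) \<le> C * (L powr s * h + L powr (s - 1) * h * S\<^sup>2)"
    and h: "0 \<le> h" "1 \<le> L" "ln (exp 1 + h) \<le> L"
    and G: "G 0 = h" "\<And>k. G (Suc k) = h * r k"
  shows "ennreal (Llog_young a (sqrt (\<Sum>k. (G k)\<^sup>2)))
      \<le> ennreal C * (ennreal (L powr s * h) +
          ennreal (L powr (s - 1)) * (ennreal h * (1 + (\<Sum>k. ennreal ((r k)\<^sup>2)))))"
    (is "_ \<le> ennreal C * ?rhs")
    and "ennreal h * (1 + (\<Sum>k. ennreal ((r k)\<^sup>2))) < \<infinity> \<Longrightarrow> summable (\<lambda>k. (G k)\<^sup>2)"
proof -
  consider "h = 0" | "h > 0" "\<not> summable (\<lambda>k. (r k)\<^sup>2)" | "h > 0" "summable (\<lambda>k. (r k)\<^sup>2)"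
    using h(1) by (auto simp: less_le)
  then have both: "ennreal (Llog_young a (sqrt (\<Sum>k. (G k)\<^sup>2))) \<le> ennreal C * ?rhs \<and>
    (ennreal h * (1 + (\<Sum>k. ennreal ((r k)\<^sup>2))) < \<infinity> \<longrightarrow> summable (\<lambda>k. (G k)\<^sup>2))"
  proof cases
    case 1
    then have "G k = 0" for k using G by (cases k) auto
    then show ?thesis by simp
  next
    case 2
    then have inf: "(\<Sum>k. ennreal ((r k)\<^sup>2)) = \<infinity>"
      using summable_suminf_not_top[of "\<lambda>k. (r k)\<^sup>2"] by fastforce
    have "ennreal h * (1 + (\<Sum>k. ennreal ((r k)\<^sup>2))) = \<infinity>"
      unfolding inf using 2 by (simp add: ennreal_mult_top)
    moreover have "ennreal (L powr (s - 1)) \<noteq> 0" "ennreal C \<noteq> 0" using h C by auto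
    ultimately show ?thesis by (simp add: ennreal_mult_top)
  next
    case 3
    define S where "S = sqrt (1 + (\<Sum>k. (r k)\<^sup>2))"
    have nn: "0 \<le> (\<Sum>k. (r k)\<^sup>2)" using 3 by (intro suminf_nonneg) auto
    have S: "0 \<le> S" "S\<^sup>2 = 1 + (\<Sum>k. (r k)\<^sup>2)" using nn by (auto simp: S_def)
    have "(\<lambda>k. h\<^sup>2 * (r k)\<^sup>2) sums (h\<^sup>2 * (\<Sum>k. (r k)\<^sup>2))"
      using 3 by (intro sums_mult summable_sums)
    then have "(\<lambda>k. (G (Suc k))\<^sup>2) sums (h\<^sup>2 * (\<Sum>k. (r k)\<^sup>2))"
      by (simp add: G power_mult_distrib)
    then have sums: "(\<lambda>k. (G k)\<^sup>2) sums (h\<^sup>2 * (\<Sum>k. (r k)\<^sup>2) + (G 0)\<^sup>2)"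
      by (subst (asm) sums_Suc_iff)
    have "h\<^sup>2 * (\<Sum>k. (r k)\<^sup>2) + (G 0)\<^sup>2 = (h * S)\<^sup>2"
      unfolding G power_mult_distrib S by (simp add: distrib_left)
    then have "sqrt (\<Sum>k. (G k)\<^sup>2) = h * S"
      unfolding sums_unique[OF sums, symmetric] using h S by simp
    then have "Llog_young a (sqrt (\<Sum>k. (G k)\<^sup>2)) \<le> C * (L powr s * h + L powr (s - 1) * h * S\<^sup>2)"
      using C(2)[OF h S(1)] by simp
    then have "ennreal (Llog_young a (sqrt (\<Sum>k. (G k)\<^sup>2)))
        \<le> ennreal (C * (L powr s * h + L powr (s - 1) * h * S\<^sup>2))"
      by (rule ennreal_leI)
    also have "\<dots> = ennreal C * (ennreal (L powr s * h) + ennreal (L powr (s - 1)) * (ennreal h * ennreal (S\<^sup>2)))"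
      using C h by (simp add: ennreal_mult ennreal_plus mult.assoc)
    also have "ennreal (S\<^sup>2) = 1 + (\<Sum>k. ennreal ((r k)\<^sup>2))"
      unfolding S using 3 nn by (simp add: ennreal_plus suminf_ennreal2)
    finally have "ennreal (Llog_young a (sqrt (\<Sum>k. (G k)\<^sup>2))) \<le> ennreal C * ?rhs" .
    then show ?thesis using sums_summable[OF sums] by (intro conjI impI)
  qed
  show "ennreal (Llog_young a (sqrt (\<Sum>k. (G k)\<^sup>2))) \<le> ennreal C * ?rhs"
    using both by (rule conjunct1)
  show "summable (\<lambda>k. (G k)\<^sup>2)" if "ennreal h * (1 + (\<Sum>k. ennreal ((r k)\<^sup>2))) < \<infinity>"
    using that by (rule both[THEN conjunct2, rule_format])
qed

lemma summable_powr_exp_levels: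
  "summable (\<lambda>j. (real j + 1) powr a * exp (- (real j + 1)))" if a: "a > -1"
proof -
  \<comment> \<open>Two powers are spent on the convergence of \<open>\<Sum> 1 / y\<^sup>2\<close>.\<close>
  obtain K where K: "K > 0" "\<And>y. y > 0 \<Longrightarrow> y powr (a + 2) \<le> K * exp y"
    by (rule powr_le_exp[of "a + 2"]) (use a in auto)
  have bound: "norm ((real j + 1) powr a * exp (- (real j + 1))) \<le> K * inverse (real (Suc j) ^ 2)" for j
  proof -
    let ?y = "real j + 1"
    have "?y powr a * ?y\<^sup>2 \<le> K * exp ?y"
      using K(2)[of ?y] unfolding powr_add by (simp add: powr_numeral)
    then have "?y powr a * ?y\<^sup>2 * exp (- ?y) \<le> K * exp ?y * exp (- ?y)"
      by (intro mult_right_mono) auto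
    also have "\<dots> = K" by (simp only: mult.assoc exp_minus_inverse mult_1_right)
    finally have "?y powr a * exp (- ?y) * ?y\<^sup>2 \<le> K" by (simp only: mult_ac)
    then have "?y powr a * exp (- ?y) \<le> K / ?y\<^sup>2" by (subst pos_le_divide_eq) simp_all
    moreover have "real (Suc j) = ?y" by simp
    moreover have "0 \<le> ?y powr a * exp (- ?y)" by simp
    ultimately show ?thesis by (simp only: divide_inverse real_norm_def abs_of_nonneg)
  qed
  have "summable (\<lambda>j. inverse (real (Suc j) ^ 2))"
    by (rule summable_Suc_iff[of "\<lambda>j. inverse (real j ^ 2)", THEN iffD2, OF inverse_power_summable[OF order_refl]])
  then have "summable (\<lambda>j. K * inverse (real (Suc j) ^ 2))" by (rule summable_mult)
  then show ?thesis by (rule summable_comparison_test') (rule bound)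
qed

text \<open>The clause \<open>g 0 = f\<close> settles \<open>D\<^sub>0\<close>; the condition on Haar coefficients stands for
  \<open>D\<^sub>k\<^sub>+\<^sub>1 f = D\<^sub>k\<^sub>+\<^sub>1 g\<^sub>k\<^sub>+\<^sub>1\<close>, which is only defined for complex functions.\<close>

definition is_lift :: "real \<Rightarrow> real \<Rightarrow> (real \<Rightarrow> real) \<Rightarrow> (nat \<Rightarrow> real \<Rightarrow> real) \<Rightarrow> bool"
  where "is_lift a K f g \<longleftrightarrow>
    g 0 = f \<and> (\<forall>k. integrable unit_space (g k)) \<and> (\<forall>k x. 0 \<le> g k x) \<and>
    (\<forall>k. \<forall>i<2 ^ k. (LINT x|unit_space. haar k i x * g (Suc k) x) = (LINT x|unit_space. haar k i x * f x)) \<and>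
    (AE x in unit_space. summable (\<lambda>k. (g k x)\<^sup>2)) \<and>
    (\<integral>\<^sup>+ x. ennreal (Llog_young a (sqrt (\<Sum>k. (g k x)\<^sup>2))) \<partial>unit_space) \<le> ennreal K"

text \<open>The function is decomposed by levels because the entropy argument on its own compares \<open>S\<^sup>2\<close> with the
  logarithm of the maximum of \<open>f\<close>. On one level this maximum is comparable to
  \<open>e + f\<close> itself.\<close>

lemma exists_lift_nonneg:
  fixes \<sigma> :: real
  assumes \<sigma>: "\<sigma> \<ge> 0"
  obtains K where "K \<ge> 1"
    "\<And>f. f \<in> borel_measurable unit_space \<Longrightarrow> (\<And>x. 0 \<le> f x) \<Longrightarrow>
      (\<integral>\<^sup>+ x. ennreal (Llog_young ((\<sigma> + 1) / 2) (f x)) \<partial>unit_space) \<le> 1 \<Longrightarrow>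
      \<exists>g. is_lift (\<sigma> / 2) K f g"
proof -
  define s where "s = (\<sigma> + 1) / 2"
  have s: "s > 0" using \<sigma> by (simp add: s_def)
  obtain C where C: "C > 0"
    "\<And>h L S. 0 \<le> h \<Longrightarrow> 1 \<le> L \<Longrightarrow> ln (exp 1 + h) \<le> L \<Longrightarrow> 0 \<le> S \<Longrightarrow>
      Llog_young (\<sigma> / 2) (h * S) \<le> C * (L powr s * h + L powr (s - 1) * h * S\<^sup>2)"
    using Llog_young_level_bound[OF \<sigma>] unfolding s_def by blast
  define T where "T = (\<Sum>j. (real j + 1) powr (s - 1) * exp (- (real j + 1)))"
  have summT: "summable (\<lambda>j. (real j + 1) powr (s - 1) * exp (- (real j + 1)))"
    using s by (intro summable_powr_exp_levels) auto
  have T: "T \<ge> 0" unfolding T_def using summT by (intro suminf_nonneg) auto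
  define K where "K = max 1 (C * (18 * 2 powr s + 8 * T))"
  show thesis
  proof
    show "K \<ge> 1" by (simp add: K_def)
    fix f :: "real \<Rightarrow> real"
    assume f [measurable]: "f \<in> borel_measurable unit_space" and f0: "\<And>x. 0 \<le> f x"
      and fB: "(\<integral>\<^sup>+ x. ennreal (Llog_young ((\<sigma> + 1) / 2) (f x)) \<partial>unit_space) \<le> 1"
    have f_int: "integrable unit_space f"
    proof (rule integrableI_nonneg)
      have "(\<integral>\<^sup>+ x. ennreal (f x) \<partial>unit_space) \<le> (\<integral>\<^sup>+ x. ennreal (Llog_young ((\<sigma> + 1) / 2) (f x)) \<partial>unit_space)"
        using f0 \<sigma> by (intro nn_integral_mono ennreal_leI Llog_young_ge_self) auto
      also have "\<dots> < \<infinity>" using fB by (simp add: order_le_less_trans)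
      finally show "(\<integral>\<^sup>+ x. ennreal (f x) \<partial>unit_space) < \<infinity>" .
    qed (auto simp: f0)
    \<comment> \<open>The level is at least \<open>1\<close>, so \<open>L = lev + 1\<close> satisfies \<open>ln (e + f) \<le> L \<le> 2 ln (e + f)\<close>.\<close>
    define lev where "lev x = nat \<lfloor>ln (exp 1 + f x)\<rfloor>" for x
    have lev [measurable]: "lev \<in> measurable unit_space (count_space UNIV)"
      unfolding lev_def by measurable
    define L where "L j = real j + 1" for j
    have L1: "1 \<le> L j" for j by (simp add: L_def)
    have levL: "ln (exp 1 + f x) \<le> L (lev x)" "L (lev x) \<le> 2 * ln (exp 1 + f x)" for x
      using ln_e_add_ge_1[OF f0, of x] unfolding lev_def L_def by linarith+
    define h where "h j x = (if lev x = j then f x else 0)" for j x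
    have h0: "0 \<le> h j x" for j x by (simp add: h_def f0)
    have h_meas [measurable]: "h j \<in> borel_measurable unit_space" for j
      unfolding h_def by measurable
    have h_int: "integrable unit_space (h j)" for j
      using f_int by (rule Bochner_Integration.integrable_bound) (auto simp: h_def)
    have hL: "h j x \<le> exp (L j)" for j x
    proof (cases "lev x = j")
      case True
      have "0 < exp 1 + f x" using f0[of x] by (intro add_pos_nonneg) auto
      then have "exp 1 + f x \<le> exp (L j)" using levL(1)[of x] True by (metis exp_le_cancel_iff exp_ln)
      moreover have "0 < exp (1::real)" by simp
      ultimately have "f x \<le> exp (L j)" by linarith
      then show ?thesis using True by (simp add: h_def)
    qed (simp add: h_def)
    define r where "r j k = gain_step (h j) k" for j k
    have r [measurable]: "r j k \<in> borel_measurable unit_space" for j k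
      unfolding r_def gain_step_def by measurable
    have r01: "0 \<le> r j k x" "r j k x \<le> 1" for j k x
      unfolding r_def using gain_step_bounds[of "h j"] h0 by auto
    define g where "g k x = (case k of 0 \<Rightarrow> f x | Suc k \<Rightarrow> f x * r (lev x) k x)" for k x
    have g0: "g 0 = f" by (simp add: g_def fun_eq_iff)
    have gSuc: "g (Suc k) x = f x * r (lev x) k x" for k x by (simp add: g_def)
    have g_meas [measurable]: "g k \<in> borel_measurable unit_space" for k
    proof (cases k)
      case (Suc k')
      have "(\<lambda>x. r (lev x) k' x) \<in> borel_measurable unit_space"
        using r lev by (rule measurable_compose_countable)
      then show ?thesis using Suc by (simp add: gSuc[abs_def])
    qed (simp add: g0)
    have g_bounds: "0 \<le> g k x" "g k x \<le> f x" for k x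
      using r01 f0 by (cases k; simp add: g0 gSuc mult_left_le)+
    have g_int: "integrable unit_space (g k)" for k
      using f_int by (rule Bochner_Integration.integrable_bound) (auto simp: g_bounds f0)
    have haar: "(LINT x|unit_space. haar k i x * g (Suc k) x) = (LINT x|unit_space. haar k i x * f x)"
      if i: "i < 2 ^ k" for k i
    proof (rule integral_eq_by_levels[OF _ _ lev])
      fix j
      have "(LINT x|unit_space. (if lev x = j then haar k i x * g (Suc k) x else 0))
          = (LINT x|unit_space. haar k i x * (h j x * gain_step (h j) k x))"
        by (intro Bochner_Integration.integral_cong) (auto simp: gSuc h_def r_def)
      also have "\<dots> = (LINT x|unit_space. haar k i x * h j x)"
        by (rule haar_coeff_gain_step[OF h_int h0 i])
      also have "\<dots> = (LINT x|unit_space. (if lev x = j then haar k i x * f x else 0))"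
        by (intro Bochner_Integration.integral_cong) (auto simp: h_def)
      finally show "(LINT x|unit_space. (if lev x = j then haar k i x * g (Suc k) x else 0)) = \<dots>" .
    qed (use integrable_haar_mult[OF g_int] integrable_haar_mult[OF f_int] in auto)
    \<comment> \<open>\<open>E j\<close> is \<open>h\<^sub>j S\<^sub>j\<^sup>2\<close>, and \<open>\<Psi> j\<close> is the bound \<open>L\<^sup>s h\<^sub>j + L\<^sup>s\<^sup>-\<^sup>1 h\<^sub>j S\<^sub>j\<^sup>2\<close> for the Young function of the
      square function on level \<open>j\<close>. Both vanish off that level, so \<open>\<Sum> \<Psi> j\<close> is a bound everywhere.\<close>
    define E where "E j x = ennreal (h j x) * (1 + (\<Sum>k. ennreal ((r j k x)\<^sup>2)))" for j x
    have E_meas [measurable]: "E j \<in> borel_measurable unit_space" for j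
      unfolding E_def by measurable
    define \<Psi> where "\<Psi> j x = ennreal (L j powr s * h j x) + ennreal (L j powr (s - 1)) * E j x" for j x
    have \<Psi>_meas [measurable]: "\<Psi> j \<in> borel_measurable unit_space" for j
      unfolding \<Psi>_def by measurable
    define m where "m j = (LINT x|unit_space. h j x)" for j
    have m0: "0 \<le> m j" for j unfolding m_def using h0 by (intro Bochner_Integration.integral_nonneg) auto
    have nn_h: "(\<integral>\<^sup>+ x. ennreal (h j x) \<partial>unit_space) = ennreal (m j)" for j
      unfolding m_def using h_int h0 by (intro nn_integral_eq_integral) auto
    have E_int: "(\<integral>\<^sup>+ x. E j x \<partial>unit_space) \<le> ennreal (17 * L j * m j + 8 * exp (- L j))" for j
    proof -
      have "(\<integral>\<^sup>+ x. E j x \<partial>unit_space) \<le> ennreal ((1 + 16 * L j) * m j + 8 * exp (- L j))"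
        using total_gain_energy[OF h_int h0 hL] unfolding E_def r_def m_def .
      also have "\<dots> \<le> ennreal (17 * L j * m j + 8 * exp (- L j))"
        using L1[of j] m0[of j] by (intro ennreal_leI add_right_mono mult_right_mono) auto
      finally show ?thesis .
    qed
    have \<Psi>_int: "(\<integral>\<^sup>+ x. \<Psi> j x \<partial>unit_space)
        \<le> ennreal 18 * ennreal (L j powr s * m j) + ennreal (8 * (L j powr (s - 1) * exp (- L j)))" for j
    proof -
      have "(\<integral>\<^sup>+ x. \<Psi> j x \<partial>unit_space)
          = ennreal (L j powr s) * ennreal (m j) + ennreal (L j powr (s - 1)) * (\<integral>\<^sup>+ x. E j x \<partial>unit_space)"
        unfolding \<Psi>_def using h0
        by (subst nn_integral_add) (auto simp: nn_integral_cmult ennreal_mult nn_h)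
      also have "\<dots> \<le> ennreal (L j powr s) * ennreal (m j)
          + ennreal (L j powr (s - 1)) * ennreal (17 * L j * m j + 8 * exp (- L j))"
        by (intro add_left_mono mult_left_mono E_int) auto
      also have "\<dots> = ennreal (L j powr s * m j + L j powr (s - 1) * (17 * L j * m j + 8 * exp (- L j)))"
        using m0[of j] L1[of j] by (simp add: ennreal_mult ennreal_plus)
      also have "L j powr s * m j + L j powr (s - 1) * (17 * L j * m j + 8 * exp (- L j))
          = 18 * (L j powr s * m j) + 8 * (L j powr (s - 1) * exp (- L j))"
      proof -
        have "L j powr (s - 1) * L j = L j powr s"
          using L1[of j] by (simp add: powr_diff)
        then show ?thesis by (simp add: algebra_simps)
      qed
      also have "ennreal \<dots> = ennreal 18 * ennreal (L j powr s * m j) + ennreal (8 * (L j powr (s - 1) * exp (- L j)))"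
        using m0[of j] by (simp add: ennreal_mult ennreal_plus)
      finally show ?thesis .
    qed
    have sum_m: "(\<Sum>j. ennreal (L j powr s * m j)) \<le> ennreal (2 powr s)"
    proof -
      have "(\<Sum>j. ennreal (L j powr s * m j)) = (\<Sum>j. \<integral>\<^sup>+ x. ennreal (L j powr s * h j x) \<partial>unit_space)"
        using h0 m0 by (intro suminf_cong) (simp add: nn_integral_cmult ennreal_mult nn_h)
      also have "\<dots> = (\<integral>\<^sup>+ x. (\<Sum>j. ennreal (L j powr s * h j x)) \<partial>unit_space)"
        by (subst nn_integral_suminf) auto
      also have "\<dots> = (\<integral>\<^sup>+ x. ennreal (L (lev x) powr s * f x) \<partial>unit_space)"
      proof (intro nn_integral_cong)
        fix x
        have "(\<Sum>j. ennreal (L j powr s * h j x)) = (\<Sum>j. if j = lev x then ennreal (L j powr s * f x) else 0)"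
          by (intro suminf_cong) (auto simp: h_def)
        then show "(\<Sum>j. ennreal (L j powr s * h j x)) = ennreal (L (lev x) powr s * f x)"
          by (simp add: suminf_single_ennreal)
      qed
      also have "\<dots> \<le> (\<integral>\<^sup>+ x. ennreal (2 powr s) * ennreal (Llog_young s (f x)) \<partial>unit_space)"
      proof (intro nn_integral_mono)
        fix x
        have "L (lev x) powr s \<le> (2 * ln (exp 1 + f x)) powr s"
          using levL(2)[of x] L1[of "lev x"] s by (intro powr_mono2) auto
        also have "\<dots> = 2 powr s * ln (exp 1 + f x) powr s"
          using ln_e_add_ge_1[OF f0, of x] by (simp only: powr_mult)
        finally have "L (lev x) powr s * f x \<le> 2 powr s * ln (exp 1 + f x) powr s * f x"
          using f0 by (intro mult_right_mono) auto
        then show "ennreal (L (lev x) powr s * f x) \<le> ennreal (2 powr s) * ennreal (Llog_young s (f x))"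
          by (subst ennreal_mult[symmetric]) (auto simp: Llog_young_def f0 mult_ac intro!: ennreal_leI)
      qed
      also have "\<dots> = ennreal (2 powr s) * (\<integral>\<^sup>+ x. ennreal (Llog_young s (f x)) \<partial>unit_space)"
        by (intro nn_integral_cmult) measurable
      also have "\<dots> \<le> ennreal (2 powr s) * 1"
        using fB unfolding s_def by (intro mult_left_mono) auto
      finally show ?thesis by simp
    qed
    have total: "(\<integral>\<^sup>+ x. (\<Sum>j. \<Psi> j x) \<partial>unit_space) \<le> ennreal (18 * 2 powr s + 8 * T)"
    proof -
      have "(\<integral>\<^sup>+ x. (\<Sum>j. \<Psi> j x) \<partial>unit_space) = (\<Sum>j. \<integral>\<^sup>+ x. \<Psi> j x \<partial>unit_space)"
        by (intro nn_integral_suminf) measurable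
      also have "\<dots> \<le> (\<Sum>j. ennreal 18 * ennreal (L j powr s * m j) + ennreal (8 * (L j powr (s - 1) * exp (- L j))))"
        by (intro suminf_le \<Psi>_int) auto
      also have "\<dots> = ennreal 18 * (\<Sum>j. ennreal (L j powr s * m j)) + (\<Sum>j. ennreal (8 * (L j powr (s - 1) * exp (- L j))))"
        by (subst suminf_add[symmetric]) auto
      also have "(\<Sum>j. ennreal (8 * (L j powr (s - 1) * exp (- L j)))) = ennreal (8 * T)"
        unfolding T_def L_def using summT
        by (subst suminf_ennreal2) (auto simp: suminf_mult)
      also have "ennreal 18 * (\<Sum>j. ennreal (L j powr s * m j)) + ennreal (8 * T)
          \<le> ennreal 18 * ennreal (2 powr s) + ennreal (8 * T)"
        by (intro add_right_mono mult_left_mono sum_m) auto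
      also have "\<dots> = ennreal (18 * 2 powr s + 8 * T)"
        using T by (simp add: ennreal_mult ennreal_plus)
      finally show ?thesis .
    qed
    have \<Psi>_lev: "\<Psi> (lev x) x \<le> (\<Sum>j. \<Psi> j x)" for x
      using sum_le_suminf[of "\<lambda>j. \<Psi> j x" "{lev x}"] by simp
    have hlev: "h (lev x) x = f x" for x by (simp add: h_def)
    have pointwise:
      "ennreal (Llog_young (\<sigma> / 2) (sqrt (\<Sum>k. (g k x)\<^sup>2))) \<le> ennreal C * \<Psi> (lev x) x"
      "E (lev x) x < \<infinity> \<Longrightarrow> summable (\<lambda>k. (g k x)\<^sup>2)" for x
    proof -
      show "ennreal (Llog_young (\<sigma> / 2) (sqrt (\<Sum>k. (g k x)\<^sup>2))) \<le> ennreal C * \<Psi> (lev x) x"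
        unfolding \<Psi>_def E_def hlev
        by (rule level_square_function_bound(1)[OF C f0 L1 levL(1),
              where G = "\<lambda>k. g k x" and r = "\<lambda>k. r (lev x) k x"]) (simp_all only: g0 gSuc)
      show "summable (\<lambda>k. (g k x)\<^sup>2)" if "E (lev x) x < \<infinity>"
      proof (rule level_square_function_bound(2)[OF C f0 L1 levL(1),
              where G = "\<lambda>k. g k x" and r = "\<lambda>k. r (lev x) k x"])
        show "ennreal (f x) * (1 + (\<Sum>k. ennreal ((r (lev x) k x)\<^sup>2))) < \<infinity>"
          using that unfolding E_def hlev .
      qed (simp_all only: g0 gSuc)
    qed
    have "AE x in unit_space. (\<Sum>j. \<Psi> j x) \<noteq> \<infinity>"
      using total by (intro nn_integral_PInf_AE) (auto simp: top_unique)
    then have "AE x in unit_space. summable (\<lambda>k. (g k x)\<^sup>2)"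
    proof (rule AE_mp, intro AE_I2 impI)
      fix x assume "(\<Sum>j. \<Psi> j x) \<noteq> \<infinity>"
      then have "\<Psi> (lev x) x < \<infinity>" using \<Psi>_lev[of x] by (auto simp: top.not_eq_extremum)
      then have "E (lev x) x < \<infinity>"
        unfolding \<Psi>_def using L1[of "lev x"]
        by (auto simp: ennreal_add_less_top ennreal_mult_less_top not_le)
      then show "summable (\<lambda>k. (g k x)\<^sup>2)" by (rule pointwise(2))
    qed
    moreover have "(\<integral>\<^sup>+ x. ennreal (Llog_young (\<sigma> / 2) (sqrt (\<Sum>k. (g k x)\<^sup>2))) \<partial>unit_space) \<le> ennreal K"
    proof -
      have "(\<integral>\<^sup>+ x. ennreal (Llog_young (\<sigma> / 2) (sqrt (\<Sum>k. (g k x)\<^sup>2))) \<partial>unit_space)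
          \<le> (\<integral>\<^sup>+ x. ennreal C * (\<Sum>j. \<Psi> j x) \<partial>unit_space)"
      proof (intro nn_integral_mono)
        fix x
        have "ennreal (Llog_young (\<sigma> / 2) (sqrt (\<Sum>k. (g k x)\<^sup>2))) \<le> ennreal C * \<Psi> (lev x) x"
          by (rule pointwise(1))
        also have "\<dots> \<le> ennreal C * (\<Sum>j. \<Psi> j x)" by (intro mult_left_mono \<Psi>_lev) auto
        finally show "ennreal (Llog_young (\<sigma> / 2) (sqrt (\<Sum>k. (g k x)\<^sup>2))) \<le> \<dots>" .
      qed
      also have "\<dots> = ennreal C * (\<integral>\<^sup>+ x. (\<Sum>j. \<Psi> j x) \<partial>unit_space)"
        by (intro nn_integral_cmult) measurable
      also have "\<dots> \<le> ennreal C * ennreal (18 * 2 powr s + 8 * T)"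
        by (intro mult_left_mono total) auto
      also have "\<dots> \<le> ennreal K"
        using C T by (subst ennreal_mult[symmetric]) (auto simp: K_def intro!: ennreal_leI)
      finally show ?thesis .
    qed
    ultimately show "\<exists>g. is_lift (\<sigma> / 2) K f g"
      unfolding is_lift_def using g0 g_int g_bounds(1) haar by blast
  qed
qed

section \<open>Complex-valued functions and the Luxemburg norm\<close>

text \<open>A quasi-triangle inequality: the largest of the four \<open>S i\<close> satisfies \<open>sqrt t \<le> 2 sqrt (S i)\<close>. The
  remaining factor \<open>1 / (4 K)\<close> can be pulled out by \<open>B(c t) \<le> c B(t)\<close>, which turns four integrals bounded
  by \<open>K\<close> into a total of at most \<open>1\<close>.\<close>

lemma Llog_young_sqrt_sum_le:
  fixes S :: "nat \<Rightarrow> real"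
  assumes "0 \<le> a" "1 \<le> K" and S: "\<And>i. 0 \<le> S i" and t: "0 \<le> t" "t \<le> (\<Sum>i<4. S i)"
  shows "Llog_young a (sqrt t / (8 * K)) \<le> 1 / (4 * K) * (\<Sum>i<4. Llog_young a (sqrt (S i)))"
proof -
  have "Max (S ` {..<4}) \<in> S ` {..<4}" by (intro Max_in) (auto simp: lessThan_empty_iff)
  then obtain i where i: "i < 4" "S i = Max (S ` {..<4})" by auto
  have "S j \<le> S i" if "j < 4" for j
    unfolding i(2) using that by (intro Max_ge) auto
  then have "(\<Sum>j<4. S j) \<le> (\<Sum>j<(4::nat). S i)" by (intro sum_mono) auto
  then have "t \<le> 4 * S i" using t by simp
  then have "sqrt t \<le> 2 * sqrt (S i)"
    using real_sqrt_le_mono[of t "4 * S i"] by (simp add: real_sqrt_mult)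
  then have "sqrt t / (8 * K) \<le> 1 / (4 * K) * sqrt (S i)"
    using assms(2) by (simp add: field_simps)
  then have "Llog_young a (sqrt t / (8 * K)) \<le> Llog_young a (1 / (4 * K) * sqrt (S i))"
    using assms(1,2) t by (intro Llog_young_mono) auto
  also have "\<dots> \<le> 1 / (4 * K) * Llog_young a (sqrt (S i))"
    using assms(1,2) S by (intro Llog_young_scale) auto
  also have "\<dots> \<le> 1 / (4 * K) * (\<Sum>i<4. Llog_young a (sqrt (S i)))"
    using i(1) assms(2) S
    by (intro mult_left_mono member_le_sum) (auto simp: Llog_young_nonneg)
  finally show ?thesis .
qed

lemma exists_lift_complex:
  fixes \<sigma> :: real
  assumes \<sigma>: "\<sigma> \<ge> 0"
  obtains K where "K \<ge> 1"
    "\<And>f :: real \<Rightarrow> complex. f \<in> borel_measurable unit_space \<Longrightarrow>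
      (\<integral>\<^sup>+ x. ennreal (Llog_young ((\<sigma> + 1) / 2) (norm (f x))) \<partial>unit_space) \<le> 1 \<Longrightarrow>
      \<exists>g :: nat \<Rightarrow> real \<Rightarrow> complex. (\<forall>k. integrable unit_space (g k)) \<and>
        (\<forall>k. dyadic_mart_diff k f = dyadic_mart_diff k (g k)) \<and>
        (AE x in unit_space. summable (\<lambda>k. (norm (g k x))\<^sup>2)) \<and>
        (\<integral>\<^sup>+ x. ennreal (Llog_young (\<sigma> / 2) (sqrt (\<Sum>k. (norm (g k x))\<^sup>2) / K)) \<partial>unit_space) \<le> 1"
proof -
  obtain K where K: "K \<ge> 1"
    and lift: "\<And>f. f \<in> borel_measurable unit_space \<Longrightarrow> (\<And>x. 0 \<le> f x) \<Longrightarrow>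
      (\<integral>\<^sup>+ x. ennreal (Llog_young ((\<sigma> + 1) / 2) (f x)) \<partial>unit_space) \<le> 1 \<Longrightarrow>
      \<exists>g. is_lift (\<sigma> / 2) K f g"
    using exists_lift_nonneg[OF \<sigma>] by blast
  define B where "B = Llog_young (\<sigma> / 2)"
  show thesis
  proof
    show "8 * K \<ge> 1" using K by simp
    fix f :: "real \<Rightarrow> complex"
    assume f [measurable]: "f \<in> borel_measurable unit_space"
      and fB: "(\<integral>\<^sup>+ x. ennreal (Llog_young ((\<sigma> + 1) / 2) (norm (f x))) \<partial>unit_space) \<le> 1"
    have part: "\<exists>g. is_lift (\<sigma> / 2) K p g"
      if [measurable]: "p \<in> borel_measurable unit_space"
        and p: "\<And>x. 0 \<le> p x" "\<And>x. p x \<le> norm (f x)" for p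
    proof (rule lift)
      have "(\<integral>\<^sup>+ x. ennreal (Llog_young ((\<sigma> + 1) / 2) (p x)) \<partial>unit_space)
          \<le> (\<integral>\<^sup>+ x. ennreal (Llog_young ((\<sigma> + 1) / 2) (norm (f x))) \<partial>unit_space)"
        using p \<sigma> by (intro nn_integral_mono ennreal_leI Llog_young_mono) auto
      then show "(\<integral>\<^sup>+ x. ennreal (Llog_young ((\<sigma> + 1) / 2) (p x)) \<partial>unit_space) \<le> 1"
        using fB by (rule order_trans)
    qed (use p in auto)
    define p where "p i x = (if i = 0 then max 0 (Re (f x)) else if i = 1 then max 0 (- Re (f x))
      else if i = 2 then max 0 (Im (f x)) else max 0 (- Im (f x)))" for i :: nat and x
    have "\<exists>g. is_lift (\<sigma> / 2) K (p i) g" for i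
    proof (rule part)
      show "p i \<in> borel_measurable unit_space" unfolding p_def by measurable
      show "0 \<le> p i x" for x by (simp add: p_def)
      show "p i x \<le> norm (f x)" for x
        using abs_Re_le_cmod[of "f x"] abs_Im_le_cmod[of "f x"] by (auto simp: p_def)
    qed
    then obtain G where G: "\<And>i. is_lift (\<sigma> / 2) K (p i) (G i)" by metis
    have G0: "G i 0 = p i" and G_int: "integrable unit_space (G i k)" and G_nn: "0 \<le> G i k x"
      and G_haar: "j < 2 ^ k \<Longrightarrow> (LINT x|unit_space. haar k j x * G i (Suc k) x) = (LINT x|unit_space. haar k j x * p i x)"
      and G_sum: "AE x in unit_space. summable (\<lambda>k. (G i k x)\<^sup>2)"
      and G_B: "(\<integral>\<^sup>+ x. ennreal (B (sqrt (\<Sum>k. (G i k x)\<^sup>2))) \<partial>unit_space) \<le> ennreal K" for i j k x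
      using G[of i] unfolding is_lift_def B_def by blast+
    have p_int: "integrable unit_space (p i)" for i using G_int[of i 0] by (simp add: G0)
    define c :: "nat \<Rightarrow> complex" where "c i = (if i = 0 then 1 else if i = 1 then -1 else if i = 2 then \<i> else -\<i>)" for i
    define g where "g k x = (\<Sum>i<4. c i * of_real (G i k x))" for k x
    have four: "{..<4::nat} = {0, 1, 2, 3}" by auto
    have f_eq: "f = (\<lambda>x. \<Sum>i<4. c i * of_real (p i x))"
      by (rule ext) (auto simp: four c_def p_def complex_eq_iff)
    have g0: "g 0 = f" by (rule ext) (simp only: g_def G0 f_eq)
    have g_int: "integrable unit_space (g k)" for k
      unfolding g_def using G_int by (intro Bochner_Integration.integrable_sum integrable_mult_right integrable_of_real)
    have f_int: "integrable unit_space f" using g_int[of 0] by (simp add: g0)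
    have coeff: "(LINT x|unit_space. haar k j x *\<^sub>R (\<Sum>i<4. c i * of_real (q i x)))
        = (\<Sum>i<4. c i * of_real (LINT x|unit_space. haar k j x * q i x))"
      if q: "\<And>i. integrable unit_space (q i)" for q k j
    proof -
      have "(LINT x|unit_space. haar k j x *\<^sub>R (\<Sum>i<4. c i * of_real (q i x)))
          = (LINT x|unit_space. (\<Sum>i<4. c i * of_real (haar k j x * q i x)))"
        by (simp only: scaleR_conv_of_real sum_distrib_left of_real_mult mult.left_commute)
      also have "\<dots> = (\<Sum>i<4. LINT x|unit_space. c i * of_real (haar k j x * q i x))"
        using integrable_haar_mult[OF q]
        by (intro Bochner_Integration.integral_sum integrable_mult_right integrable_of_real) simp
      also have "\<dots> = (\<Sum>i<4. c i * of_real (LINT x|unit_space. haar k j x * q i x))"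
        by (simp only: integral_mult_right_zero integral_complex_of_real)
      finally show ?thesis .
    qed
    have "dyadic_mart_diff k f = dyadic_mart_diff k (g k)" for k
    proof (cases k)
      case (Suc l)
      have "(LINT x|unit_space. haar l j x *\<^sub>R f x) = (LINT x|unit_space. haar l j x *\<^sub>R g k x)"
        if "j < 2 ^ l" for j
      proof -
        have "(LINT x|unit_space. haar l j x *\<^sub>R f x)
            = (\<Sum>i<4. c i * of_real (LINT x|unit_space. haar l j x * p i x))"
          unfolding f_eq by (rule coeff[OF p_int])
        also have "\<dots> = (\<Sum>i<4. c i * of_real (LINT x|unit_space. haar l j x * G i (Suc l) x))"
          by (simp only: G_haar[OF that])
        also have "\<dots> = (LINT x|unit_space. haar l j x *\<^sub>R g k x)"
          unfolding g_def Suc by (rule coeff[OF G_int, symmetric])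
        finally show ?thesis .
      qed
      then show ?thesis
        unfolding Suc
        by (intro ext, unfold dyadic_mart_diff_Suc_eq_haar[OF f_int] dyadic_mart_diff_Suc_eq_haar[OF g_int])
          (intro sum.cong refl, simp)
    qed (simp add: g0)
    moreover
    \<comment> \<open>For nonnegative \<open>a, b\<close> one has \<open>(a - b)\<^sup>2 \<le> a\<^sup>2 + b\<^sup>2\<close>, so recombining the parts costs no constant here.\<close>
    have norm_g: "(norm (g k x))\<^sup>2 \<le> (\<Sum>i<4. (G i k x)\<^sup>2)" for k x
    proof -
      have diff: "(a - b)\<^sup>2 \<le> a\<^sup>2 + b\<^sup>2" if "0 \<le> a" "0 \<le> b" for a b :: real
        using that by (simp add: power2_diff)
      have "(norm (g k x))\<^sup>2 = (G 0 k x - G 1 k x)\<^sup>2 + (G 2 k x - G 3 k x)\<^sup>2"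
        unfolding cmod_power2 by (simp add: g_def four c_def)
      then show ?thesis
        using diff[OF G_nn G_nn, of 0 k x 1 k x] diff[OF G_nn G_nn, of 2 k x 3 k x] by (simp add: four)
    qed
    have G_sum_all: "AE x in unit_space. \<forall>i. summable (\<lambda>k. (G i k x)\<^sup>2)"
      using G_sum by (simp add: AE_all_countable)
    have g_sum: "summable (\<lambda>k. (norm (g k x))\<^sup>2)" if "\<forall>i. summable (\<lambda>k. (G i k x)\<^sup>2)" for x
    proof (rule summable_comparison_test')
      show "summable (\<lambda>k. \<Sum>i<4. (G i k x)\<^sup>2)" using that by (intro summable_sum) auto
      show "norm ((norm (g k x))\<^sup>2) \<le> (\<Sum>i<4. (G i k x)\<^sup>2)" if "k \<ge> 0" for k using norm_g by simp
    qed
    have "AE x in unit_space. summable (\<lambda>k. (norm (g k x))\<^sup>2)"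
      using G_sum_all by (rule AE_mp) (intro AE_I2 impI g_sum)
    moreover have "(\<integral>\<^sup>+ x. ennreal (B (sqrt (\<Sum>k. (norm (g k x))\<^sup>2) / (8 * K))) \<partial>unit_space) \<le> 1"
    proof -
      have G_meas [measurable]: "G i k \<in> borel_measurable unit_space" for i k
        using G_int by (rule borel_measurable_integrable)
      have B_meas [measurable]: "B \<in> borel_measurable borel" unfolding B_def by measurable
      have "(\<integral>\<^sup>+ x. ennreal (B (sqrt (\<Sum>k. (norm (g k x))\<^sup>2) / (8 * K))) \<partial>unit_space)
          \<le> (\<integral>\<^sup>+ x. ennreal (1 / (4 * K)) * (\<Sum>i<4. ennreal (B (sqrt (\<Sum>k. (G i k x)\<^sup>2)))) \<partial>unit_space)"
      proof (rule nn_integral_mono_AE, rule AE_mp[OF G_sum_all], intro AE_I2 impI)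
        fix x assume summ: "\<forall>i. summable (\<lambda>k. (G i k x)\<^sup>2)"
        define S where "S i = (\<Sum>k. (G i k x)\<^sup>2)" for i
        have S0: "0 \<le> S i" for i unfolding S_def using summ by (intro suminf_nonneg) auto
        have "(\<Sum>k. (norm (g k x))\<^sup>2) \<le> (\<Sum>k. \<Sum>i<4. (G i k x)\<^sup>2)"
          using summ by (intro suminf_le norm_g g_sum summable_sum) auto
        also have "\<dots> = (\<Sum>i<4. S i)" unfolding S_def using summ by (intro suminf_sum) auto
        finally have le: "(\<Sum>k. (norm (g k x))\<^sup>2) \<le> (\<Sum>i<4. S i)" .
        have "0 \<le> (\<Sum>k. (norm (g k x))\<^sup>2)"
          by (rule suminf_nonneg[OF g_sum[OF summ]]) simp
        then have "B (sqrt (\<Sum>k. (norm (g k x))\<^sup>2) / (8 * K)) \<le> 1 / (4 * K) * (\<Sum>i<4. B (sqrt (S i)))"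
          unfolding B_def using \<sigma> K S0 le by (intro Llog_young_sqrt_sum_le) auto
        then have "ennreal (B (sqrt (\<Sum>k. (norm (g k x))\<^sup>2) / (8 * K)))
            \<le> ennreal (1 / (4 * K) * (\<Sum>i<4. B (sqrt (S i))))" by (rule ennreal_leI)
        also have "\<dots> = ennreal (1 / (4 * K)) * (\<Sum>i<4. ennreal (B (sqrt (S i))))"
        proof -
          have B0: "0 \<le> B (sqrt (S i))" for i using S0 by (simp add: B_def Llog_young_nonneg)
          have "ennreal (1 / (4 * K) * (\<Sum>i<4. B (sqrt (S i))))
              = ennreal (1 / (4 * K)) * ennreal (\<Sum>i<4. B (sqrt (S i)))"
            using K B0 by (intro ennreal_mult sum_nonneg) auto
          also have "ennreal (\<Sum>i<4. B (sqrt (S i))) = (\<Sum>i<4. ennreal (B (sqrt (S i))))"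
            using B0 by (rule sum_ennreal[symmetric])
          finally show ?thesis .
        qed
        finally show "ennreal (B (sqrt (\<Sum>k. (norm (g k x))\<^sup>2) / (8 * K)))
          \<le> ennreal (1 / (4 * K)) * (\<Sum>i<4. ennreal (B (sqrt (\<Sum>k. (G i k x)\<^sup>2))))"
          unfolding S_def .
      qed
      also have "\<dots> = ennreal (1 / (4 * K)) * (\<integral>\<^sup>+ x. (\<Sum>i<4. ennreal (B (sqrt (\<Sum>k. (G i k x)\<^sup>2)))) \<partial>unit_space)"
        by (rule nn_integral_cmult) measurable
      also have "(\<integral>\<^sup>+ x. (\<Sum>i<4. ennreal (B (sqrt (\<Sum>k. (G i k x)\<^sup>2)))) \<partial>unit_space)
          = (\<Sum>i<4. \<integral>\<^sup>+ x. ennreal (B (sqrt (\<Sum>k. (G i k x)\<^sup>2))) \<partial>unit_space)"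
        by (rule nn_integral_sum) measurable
      also have "ennreal (1 / (4 * K)) * \<dots> \<le> ennreal (1 / (4 * K)) * (\<Sum>i<(4::nat). ennreal K)"
        by (rule mult_left_mono[OF sum_mono]) (rule G_B, simp)
      also have "\<dots> = ennreal (1 / (4 * K)) * ennreal (4 * K)"
        using K by (simp add: ennreal_mult)
      also have "\<dots> = 1"
        using K by (subst ennreal_mult[symmetric]) auto
      finally show ?thesis .
    qed
    ultimately show "\<exists>g :: nat \<Rightarrow> real \<Rightarrow> complex. (\<forall>k. integrable unit_space (g k)) \<and>
        (\<forall>k. dyadic_mart_diff k f = dyadic_mart_diff k (g k)) \<and>
        (AE x in unit_space. summable (\<lambda>k. (norm (g k x))\<^sup>2)) \<and>
        (\<integral>\<^sup>+ x. ennreal (Llog_young (\<sigma> / 2) (sqrt (\<Sum>k. (norm (g k x))\<^sup>2) / (8 * K))) \<partial>unit_space) \<le> 1"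
      using g_int unfolding B_def by blast
  qed
qed

lemma Llog_norm_le:
  assumes "0 < l" "(\<integral>\<^sup>+ x. ennreal (Llog_young s (norm (f x) / l)) \<partial>unit_space) \<le> 1"
  shows "Llog_norm s f \<le> ennreal l"
  unfolding Llog_norm_def using assms by (intro Inf_lower) auto

lemma Llog_norm_less_obtain:
  assumes "Llog_norm s f < b"
  obtains l where "0 < l" "ennreal l < b"
    "(\<integral>\<^sup>+ x. ennreal (Llog_young s (norm (f x) / l)) \<partial>unit_space) \<le> 1"
  using assms unfolding Llog_norm_def Inf_less_iff by blast

lemma Llog_norm_zero: "Llog_norm s (\<lambda>x. 0 :: 'a::real_normed_vector) = 0"
proof -
  have "Llog_norm s (\<lambda>x. 0 :: 'a) \<le> 0 + ennreal e" if "e > 0" for e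
    using Llog_norm_le[OF that, of s "\<lambda>x. 0 :: 'a"] by simp
  then have "Llog_norm s (\<lambda>x. 0 :: 'a) \<le> 0" by (rule ennreal_le_epsilon)
  then show ?thesis by simp
qed

lemma Llog_norm_eq_0_imp_AE:
  fixes f :: "real \<Rightarrow> 'a::{real_normed_vector, second_countable_topology}"
  assumes s: "0 \<le> s" and f [measurable]: "f \<in> borel_measurable unit_space" and 0: "Llog_norm s f = 0"
  shows "AE x in unit_space. f x = 0"
proof -
  have "(\<integral>\<^sup>+ x. ennreal (norm (f x)) \<partial>unit_space) \<le> 0 + ennreal e" if e: "e > 0" for e
  proof -
    obtain l where l: "0 < l" "ennreal l < ennreal e"
      and B: "(\<integral>\<^sup>+ x. ennreal (Llog_young s (norm (f x) / l)) \<partial>unit_space) \<le> 1"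
      using Llog_norm_less_obtain[of s f "ennreal e"] 0 e by auto
    have "(\<integral>\<^sup>+ x. ennreal (norm (f x)) \<partial>unit_space)
        \<le> (\<integral>\<^sup>+ x. ennreal l * ennreal (Llog_young s (norm (f x) / l)) \<partial>unit_space)"
    proof (intro nn_integral_mono)
      fix x
      have "norm (f x) / l \<le> Llog_young s (norm (f x) / l)" using l s by (intro Llog_young_ge_self) auto
      then have "norm (f x) \<le> l * Llog_young s (norm (f x) / l)" using l by (simp add: field_simps)
      then show "ennreal (norm (f x)) \<le> ennreal l * ennreal (Llog_young s (norm (f x) / l))"
        using l by (subst ennreal_mult[symmetric]) (auto simp: Llog_young_nonneg intro: ennreal_leI)
    qed
    also have "\<dots> = ennreal l * (\<integral>\<^sup>+ x. ennreal (Llog_young s (norm (f x) / l)) \<partial>unit_space)"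
      by (intro nn_integral_cmult) measurable
    also have "\<dots> \<le> ennreal l * 1" using B by (intro mult_left_mono) auto
    also have "\<dots> \<le> 0 + ennreal e" using l(2) by simp
    finally show ?thesis .
  qed
  then have "(\<integral>\<^sup>+ x. ennreal (norm (f x)) \<partial>unit_space) \<le> 0" by (rule ennreal_le_epsilon)
  then show ?thesis by (simp add: nn_integral_0_iff_AE)
qed

lemma dyadic_cond_exp_scaleR: "dyadic_cond_exp k (\<lambda>x. c *\<^sub>R u x) = (\<lambda>x. c *\<^sub>R dyadic_cond_exp k u x)"
  by (rule ext) (simp only: dyadic_cond_exp_eq scaleR_left_commute[of _ c] integral_scaleR_right scaleR_sum_right)

lemma dyadic_mart_diff_scaleR: "dyadic_mart_diff k (\<lambda>x. c *\<^sub>R u x) = (\<lambda>x. c *\<^sub>R dyadic_mart_diff k u x)"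
  by (rule ext) (cases k; simp add: dyadic_cond_exp_scaleR scaleR_diff_right)

lemma dyadic_mart_diff_AE_zero:
  assumes "f \<in> borel_measurable unit_space" "AE x in unit_space. f x = 0"
  shows "dyadic_mart_diff k f = dyadic_mart_diff k (\<lambda>x. 0)"
proof -
  have "(LINT y|unit_space. indicator (dyadic_cell k i) y *\<^sub>R f y)
      = (LINT y|unit_space. indicator (dyadic_cell k i) y *\<^sub>R 0)" for k i
  proof (rule integral_cong_AE)
    show "(\<lambda>y. indicator (dyadic_cell k i) y *\<^sub>R f y) \<in> borel_measurable unit_space"
      using assms(1) by measurable
  qed (use assms(2) in \<open>auto elim: eventually_mono\<close>)
  then have "dyadic_cond_exp k f = dyadic_cond_exp k (\<lambda>x. 0)" for k
    by (intro ext) (simp only: dyadic_cond_exp_eq)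
  then show ?thesis by (intro ext) (cases k; simp)
qed

theorem theorem4:
  fixes \<sigma> :: real
  assumes "\<sigma> \<ge> 0"
  shows "\<exists>C::real. C > 0 \<and>
    (\<forall>f :: real \<Rightarrow> complex. f \<in> Llog_space ((\<sigma> + 1) / 2) \<longrightarrow>
      (\<exists>g :: nat \<Rightarrow> real \<Rightarrow> complex.
         (\<forall>k. integrable unit_space (g k)) \<and>
         (\<forall>k. dyadic_mart_diff k f = dyadic_mart_diff k (g k)) \<and>
         (AE x in unit_space. summable (\<lambda>k. (norm (g k x))\<^sup>2)) \<and>
         Llog_norm (\<sigma> / 2) (\<lambda>x. sqrt (\<Sum>k. (norm (g k x))\<^sup>2))
           \<le> ennreal C * Llog_norm ((\<sigma> + 1) / 2) f))"
proof -
  obtain K where K: "K \<ge> 1"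
    and lift: "\<And>f :: real \<Rightarrow> complex. f \<in> borel_measurable unit_space \<Longrightarrow>
      (\<integral>\<^sup>+ x. ennreal (Llog_young ((\<sigma> + 1) / 2) (norm (f x))) \<partial>unit_space) \<le> 1 \<Longrightarrow>
      \<exists>g :: nat \<Rightarrow> real \<Rightarrow> complex. (\<forall>k. integrable unit_space (g k)) \<and>
        (\<forall>k. dyadic_mart_diff k f = dyadic_mart_diff k (g k)) \<and>
        (AE x in unit_space. summable (\<lambda>k. (norm (g k x))\<^sup>2)) \<and>
        (\<integral>\<^sup>+ x. ennreal (Llog_young (\<sigma> / 2) (sqrt (\<Sum>k. (norm (g k x))\<^sup>2) / K)) \<partial>unit_space) \<le> 1"
    using exists_lift_complex[OF assms] by blast
  show ?thesis
  proof (intro exI[of _ "2 * K"] conjI allI impI)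
    show "0 < 2 * K" using K by simp
    fix f :: "real \<Rightarrow> complex"
    assume "f \<in> Llog_space ((\<sigma> + 1) / 2)"
    then have f [measurable]: "f \<in> borel_measurable unit_space"
      and fin: "Llog_norm ((\<sigma> + 1) / 2) f < \<infinity>" by (auto simp: Llog_space_def)
    define N where "N = Llog_norm ((\<sigma> + 1) / 2) f"
    show "\<exists>g :: nat \<Rightarrow> real \<Rightarrow> complex.
         (\<forall>k. integrable unit_space (g k)) \<and>
         (\<forall>k. dyadic_mart_diff k f = dyadic_mart_diff k (g k)) \<and>
         (AE x in unit_space. summable (\<lambda>k. (norm (g k x))\<^sup>2)) \<and>
         Llog_norm (\<sigma> / 2) (\<lambda>x. sqrt (\<Sum>k. (norm (g k x))\<^sup>2))
           \<le> ennreal (2 * K) * Llog_norm ((\<sigma> + 1) / 2) f"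
    proof (cases "N = 0")
      case True
      then have "AE x in unit_space. f x = 0"
        using assms f unfolding N_def by (intro Llog_norm_eq_0_imp_AE) auto
      then show ?thesis
        using dyadic_mart_diff_AE_zero[OF f]
        by (intro exI[of _ "\<lambda>k x. 0"]) (simp add: Llog_norm_zero)
    next
      case False
      \<comment> \<open>The construction depends on the normalisation, so one nearly optimal \<open>l\<close> has to be fixed.\<close>
      have "N < 2 * N"
        using False fin unfolding N_def by (cases "Llog_norm ((\<sigma> + 1) / 2) f") (auto simp: ennreal_less_iff simp flip: ennreal_numeral ennreal_mult)
      then obtain l where l: "0 < l" "ennreal l < 2 * N"
        and B: "(\<integral>\<^sup>+ x. ennreal (Llog_young ((\<sigma> + 1) / 2) (norm (f x) / l)) \<partial>unit_space) \<le> 1"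
        unfolding N_def by (rule Llog_norm_less_obtain)
      define u where "u x = (1 / l) *\<^sub>R f x" for x
      have u_meas: "u \<in> borel_measurable unit_space" unfolding u_def by measurable
      have "(\<integral>\<^sup>+ x. ennreal (Llog_young ((\<sigma> + 1) / 2) (norm (u x))) \<partial>unit_space) \<le> 1"
        using B l by (simp add: u_def)
      from lift[OF u_meas this] obtain g :: "nat \<Rightarrow> real \<Rightarrow> complex" where
        g_int: "\<And>k. integrable unit_space (g k)" and
        g_diff: "\<And>k. dyadic_mart_diff k u = dyadic_mart_diff k (g k)" and
        g_sum: "AE x in unit_space. summable (\<lambda>k. (norm (g k x))\<^sup>2)" and
        g_B: "(\<integral>\<^sup>+ x. ennreal (Llog_young (\<sigma> / 2) (sqrt (\<Sum>k. (norm (g k x))\<^sup>2) / K)) \<partial>unit_space) \<le> 1"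
        by blast
      define G where "G k x = l *\<^sub>R g k x" for k x
      have f_eq: "f = (\<lambda>x. l *\<^sub>R u x)" using l by (simp add: u_def)
      have "dyadic_mart_diff k f = dyadic_mart_diff k (G k)" for k
        unfolding f_eq G_def dyadic_mart_diff_scaleR g_diff ..
      moreover have "integrable unit_space (G k)" for k
        unfolding G_def using g_int by (intro integrable_scaleR_right)
      moreover have norm_G: "(norm (G k x))\<^sup>2 = l\<^sup>2 * (norm (g k x))\<^sup>2" for k x
        by (simp add: G_def power_mult_distrib)
      then have "AE x in unit_space. summable (\<lambda>k. (norm (G k x))\<^sup>2)"
        using g_sum by (auto elim!: eventually_mono intro: summable_mult)
      moreover have "Llog_norm (\<sigma> / 2) (\<lambda>x. sqrt (\<Sum>k. (norm (G k x))\<^sup>2)) \<le> ennreal (2 * K) * N"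
      proof -
        have "Llog_norm (\<sigma> / 2) (\<lambda>x. sqrt (\<Sum>k. (norm (G k x))\<^sup>2)) \<le> ennreal (K * l)"
        proof (rule Llog_norm_le)
          show "0 < K * l" using K l by simp
          have "AE x in unit_space. norm (sqrt (\<Sum>k. (norm (G k x))\<^sup>2)) / (K * l) = sqrt (\<Sum>k. (norm (g k x))\<^sup>2) / K"
            using g_sum
          proof (rule AE_mp, intro AE_I2 impI)
            fix x assume s: "summable (\<lambda>k. (norm (g k x))\<^sup>2)"
            then have "0 \<le> (\<Sum>k. (norm (g k x))\<^sup>2)" by (intro suminf_nonneg) auto
            then show "norm (sqrt (\<Sum>k. (norm (G k x))\<^sup>2)) / (K * l) = sqrt (\<Sum>k. (norm (g k x))\<^sup>2) / K"
              using l K by (simp add: norm_G suminf_mult[OF s] real_sqrt_mult)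
          qed
          then have "(\<integral>\<^sup>+ x. ennreal (Llog_young (\<sigma> / 2) (norm (sqrt (\<Sum>k. (norm (G k x))\<^sup>2)) / (K * l))) \<partial>unit_space)
              = (\<integral>\<^sup>+ x. ennreal (Llog_young (\<sigma> / 2) (sqrt (\<Sum>k. (norm (g k x))\<^sup>2) / K)) \<partial>unit_space)"
            by (intro nn_integral_cong_AE) (auto elim: eventually_mono)
          then show "(\<integral>\<^sup>+ x. ennreal (Llog_young (\<sigma> / 2) (norm (sqrt (\<Sum>k. (norm (G k x))\<^sup>2)) / (K * l))) \<partial>unit_space) \<le> 1"
            using g_B by simp
        qed
        also have "\<dots> = ennreal K * ennreal l" using K l by (simp add: ennreal_mult)
        also have "\<dots> \<le> ennreal K * (2 * N)" using l by (intro mult_left_mono) auto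
        also have "\<dots> = ennreal (2 * K) * N" using K by (simp add: ennreal_mult mult_ac)
        finally show ?thesis .
      qed
      ultimately show ?thesis unfolding N_def by blast
    qed
  qed
qed

end
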